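(* Let $p$ be a prime with $p\equiv 3\pmod 4$. Then $$\sum_{k=0}^{p-1}\frac{\binom{2k}{k}^2}{8^k}\equiv-\sum_{k=0}^{p-1}\frac{\binom{2k}{k}^2}{(-16)^k}\pmod{p^3}.$$
   Context: For a prime $p$ and rational numbers $a,b$ whose denominators are not divisible by $p$, $a\equiv b\pmod{p^m}$ means that $(a-b)/p^m$ is a rational number whose denominator is not divisible by $p$. *)

theory Defs
  imports Complex_Main "HOL-Computational_Algebra.Primes"
begin

definition p_integral :: "nat \<Rightarrow> rat \<Rightarrow> bool" where
  "p_integral p x \<longleftrightarrow> \<not> (int p dvd snd (quotient_of x))"

definition rat_cong_pow :: "rat \<Rightarrow> rat \<Rightarrow> nat \<Rightarrow> nat \<Rightarrow> bool" where
  "rat_cong_pow a b p m \<longleftrightarrow> p_integral p ((a - b) / of_nat (p ^ m))"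

end

theory Submission
  imports Defs "HOL-Computational_Algebra.Polynomial"
begin

text \<open>
Write p = 2n + 1, a(k) = binom(2k,k) / 4^k and F(x) = sum of a(k)^2 x^k over k < p; the claim is
F(2) + F(-1) = 0 modulo p^3. Let P(x) be the Legendre polynomial of degree n at 1 - 2x. Since
n is odd, P(1-x) = -P(x), and F agrees with P coefficientwise modulo p^2, so H(x) = F(x) + F(1-x)
vanishes modulo p^2. Both P and F nearly satisfy the same hypergeometric equation, so the derivative
of the Wronskian W = x(1-x)(P H' - P' H) is, up to p^4, a multiple c = 0 (mod p^2) of
P(x) (x^(p-1) + (1-x)^(p-1)). Integrating from 0 to -1 (division by the index p costs one factor p)
gives W(-1) modulo p^3. As P(-1) = 0 modulo p (here lambda = -1 is supersingular) and P'(-1) is a unit,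
the claim reduces to the vanishing of that integral modulo p, that is, to
T - Q(1) + 2 Q(2) - Q(-1) = 0 (mod p), where Q(x) is the sum of a(k)^2 x^k / k over 1 \<le> k \<le> n
and T = (2^p - 2) / p.

Now Q(1) = -2 (1 + 1/2 + ... + 1/n) modulo p. The values Q(2) and Q(-1) are related by an integrated
form of Landen's transformation r^2 --> 4r / (1+r)^2 at r = i, which maps -1 to 2. What remains are
the classical congruences between harmonic sums and T, obtained by expanding (1+1)^p and (1+i)^p.
\<close>

section \<open>Divisibility of rationals by prime powers\<close>

text \<open>Says that the p-adic valuation of \<open>x\<close> is at least \<open>m\<close>; a
  congruence modulo p^m becomes \<open>pmult p m (a - b)\<close>.\<close>

definition pmult :: "nat \<Rightarrow> nat \<Rightarrow> rat \<Rightarrow> bool" where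
  "pmult p m x \<longleftrightarrow> p_integral p (x / of_nat (p ^ m))"

text \<open>Any fraction may serve as a witness, because the reduced denominator divides every other
  denominator.\<close>

lemma p_integral_iff:
  assumes "prime p"
  shows "p_integral p x \<longleftrightarrow> (\<exists>a b. x = of_int a / of_int b \<and> \<not> int p dvd b)"
proof
  assume "p_integral p x"
  then show "\<exists>a b. x = of_int a / of_int b \<and> \<not> int p dvd b"
    unfolding p_integral_def by (metis prod.collapse quotient_of_div)
next
  assume "\<exists>a b. x = of_int a / of_int b \<and> \<not> int p dvd b"
  then obtain a b where x: "x = of_int a / of_int b" and b: "\<not> int p dvd b" by blast
  obtain c d where cd: "quotient_of x = (c, d)" by force
  then have x': "x = of_int c / of_int d" and "d > 0" and co: "coprime c d"
    by (auto dest: quotient_of_div quotient_of_denom_pos quotient_of_coprime)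
  have "b \<noteq> 0" using b by auto
  have "of_int a * of_int d = (of_int c * of_int b :: rat)"
    using x x' \<open>d > 0\<close> \<open>b \<noteq> 0\<close> by (simp add: field_simps)
  then have "a * d = c * b" by (metis of_int_eq_iff of_int_mult)
  then have "d dvd b"
    using co by (metis coprime_commute coprime_dvd_mult_right_iff dvd_triv_right)
  then show "p_integral p x"
    using b cd unfolding p_integral_def by (auto dest: dvd_trans)
qed

context
  fixes p :: nat
  assumes p: "prime p"
begin

lemma pmult_0_iff: "pmult p 0 x \<longleftrightarrow> p_integral p x"
  by (simp add: pmult_def)

lemma pmult_iff: "pmult p m x \<longleftrightarrow> (\<exists>y. pmult p 0 y \<and> x = of_nat p ^ m * y)"
proof
  assume "pmult p m x"
  then show "\<exists>y. pmult p 0 y \<and> x = of_nat p ^ m * y"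
    using prime_gt_0_nat[OF p]
    by (intro exI[of _ "x / of_nat (p ^ m)"]) (simp add: pmult_def)
next
  assume "\<exists>y. pmult p 0 y \<and> x = of_nat p ^ m * y"
  then show "pmult p m x" using prime_gt_0_nat[OF p] by (auto simp: pmult_def)
qed

lemma pmult_0_add: "pmult p 0 x \<Longrightarrow> pmult p 0 y \<Longrightarrow> pmult p 0 (x + y)"
  and pmult_0_mult: "pmult p 0 x \<Longrightarrow> pmult p 0 y \<Longrightarrow> pmult p 0 (x * y)"
proof -
  assume "pmult p 0 x" "pmult p 0 y"
  then obtain a b c d where *: "x = of_int a / of_int b" "\<not> int p dvd b"
      "y = of_int c / of_int d" "\<not> int p dvd d"
    by (auto simp: pmult_0_iff p_integral_iff[OF p])
  then have bd: "\<not> int p dvd b * d" using p by (simp add: prime_dvd_mult_iff)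
  then have "b \<noteq> 0" "d \<noteq> 0" by auto
  then have "x + y = of_int (a * d + c * b) / of_int (b * d)"
    using * by (simp add: field_simps)
  with bd show "pmult p 0 (x + y)"
    unfolding pmult_0_iff p_integral_iff[OF p] by blast
  have "x * y = of_int (a * c) / of_int (b * d)" using * by simp
  with bd show "pmult p 0 (x * y)"
    unfolding pmult_0_iff p_integral_iff[OF p] by blast
qed

lemma pmult_of_int [simp]: "pmult p 0 (of_int k)"
  unfolding pmult_0_iff p_integral_iff[OF p]
  using p by (intro exI[of _ k] exI[of _ 1]) (auto simp: prime_int_nat_transfer)

lemma pmult_of_nat [simp]: "pmult p 0 (of_nat k)"
  using pmult_of_int[of "int k"] by simp

lemma pmult_numeral [simp]: "pmult p 0 (numeral k)"
  using pmult_of_int[of "numeral k"] by simp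

lemma pmult_1 [simp]: "pmult p 0 1"
  using pmult_of_int[of 1] by simp

lemma pmult_0 [simp]: "pmult p m 0"
  using pmult_of_int[of 0] by (simp add: pmult_def)

lemma pmult_add: "pmult p m x \<Longrightarrow> pmult p m y \<Longrightarrow> pmult p m (x + y)"
  using pmult_0_add[of "x / of_nat (p ^ m)" "y / of_nat (p ^ m)"]
  by (simp add: pmult_def add_divide_distrib)

lemma pmult_mult: "pmult p i x \<Longrightarrow> pmult p j y \<Longrightarrow> pmult p (i + j) (x * y)"
  using pmult_0_mult[of "x / of_nat (p ^ i)" "y / of_nat (p ^ j)"]
  by (simp add: pmult_def power_add)

lemma pmult_mult_left: "pmult p 0 x \<Longrightarrow> pmult p m y \<Longrightarrow> pmult p m (x * y)"
  using pmult_mult[of 0 x m y] by simp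

lemma pmult_mult_right: "pmult p m x \<Longrightarrow> pmult p 0 y \<Longrightarrow> pmult p m (x * y)"
  using pmult_mult[of m x 0 y] by simp

lemma pmult_minus: "pmult p m x \<Longrightarrow> pmult p m (- x)"
  using pmult_mult_left[of "of_int (-1)" m x] pmult_of_int[of "-1"] by simp

lemma pmult_diff: "pmult p m x \<Longrightarrow> pmult p m y \<Longrightarrow> pmult p m (x - y)"
  using pmult_add[of m x "- y"] pmult_minus[of m y] by simp

lemma pmult_sum: "(\<And>k. k \<in> S \<Longrightarrow> pmult p m (f k)) \<Longrightarrow> pmult p m (sum f S)"
  by (induction S rule: infinite_finite_induct) (auto intro: pmult_add)

lemma pmult_0_power: "pmult p 0 x \<Longrightarrow> pmult p 0 (x ^ k)"
  by (induction k) (auto intro: pmult_mult_left)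

lemma pmult_p_power: "pmult p m (of_nat p ^ m)"
  unfolding pmult_iff[of m] by (intro exI[of _ 1]) simp

lemma pmult_p: "pmult p 1 (of_nat p)"
  using pmult_p_power[of 1] by simp

lemma pmult_mono: "pmult p j x \<Longrightarrow> i \<le> j \<Longrightarrow> pmult p i x"
proof -
  assume "pmult p j x" and ij: "i \<le> j"
  then obtain y where y: "pmult p 0 y" "x = of_nat p ^ j * y" by (auto simp: pmult_iff[of j])
  have "x = of_nat p ^ i * (of_nat p ^ (j - i) * y)"
    using y ij by (simp flip: power_add mult.assoc)
  moreover have "pmult p 0 (of_nat p ^ (j - i) * y)"
    using y by (intro pmult_mult_left pmult_0_power) auto
  ultimately show ?thesis unfolding pmult_iff[of i] by blast
qed

lemma pmult_inverse: "\<not> int p dvd k \<Longrightarrow> pmult p 0 (1 / of_int k)"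
  unfolding pmult_0_iff p_integral_iff[OF p] by (intro exI[of _ 1] exI[of _ k]) simp

lemma pmult_inverse_nat: "\<not> p dvd k \<Longrightarrow> pmult p 0 (1 / of_nat k)"
  using pmult_inverse[of "int k"] by simp

lemma pmult_cancel:
  assumes "pmult p m (of_int k * x)" and "\<not> int p dvd k"
  shows "pmult p m x"
proof -
  have "k \<noteq> 0" using assms(2) by auto
  then have "x = (1 / of_int k) * (of_int k * x)" by simp
  then show ?thesis using pmult_mult_left[OF pmult_inverse[OF assms(2)] assms(1)] by simp
qed

lemma pmult_cancel_nat:
  assumes "pmult p m (of_nat k * x)" and "\<not> p dvd k"
  shows "pmult p m x"
  using pmult_cancel[of m "int k" x] assms by simp

lemma pmult_p_cancel:
  assumes "pmult p (Suc m) (of_nat p * x)"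
  shows "pmult p m x"
  using assms prime_gt_0_nat[OF p] unfolding pmult_def by simp

lemma pmult_1_of_int: "pmult p 1 (of_int k) \<longleftrightarrow> int p dvd k"
proof
  assume "pmult p 1 (of_int k)"
  then obtain y where "pmult p 0 y" and y: "of_int k = of_nat p * y"
    by (auto simp: pmult_iff[of "Suc 0"])
  then obtain a b where ab: "y = of_int a / of_int b" "\<not> int p dvd b"
    by (auto simp: pmult_0_iff p_integral_iff[OF p])
  then have "b \<noteq> 0" by auto
  then have "of_int (k * b) = (of_int (int p * a) :: rat)" using y ab by (simp add: field_simps)
  then have "k * b = int p * a" by (simp only: of_int_eq_iff)
  then have "int p dvd k * b" by simp
  then show "int p dvd k" using ab p by (simp add: prime_dvd_mult_iff)
next
  assume "int p dvd k"
  then obtain l where "k = int p * l" by blast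
  then show "pmult p 1 (of_int k)" using pmult_mult_right[OF pmult_p, of "of_int l"] by simp
qed

end

section \<open>Legendre coefficients and a sum of Watson type\<close>

text \<open>Equals (1/2)_k / k!, so its squares are the coefficients of the hypergeometric series
  with parameters 1/2, 1/2; 1.\<close>

definition cbin :: "nat \<Rightarrow> rat" where
  "cbin k = of_nat (2 * k choose k) / 4 ^ k"

text \<open>This is (m choose k) (m+k choose k), up to sign a Legendre coefficient. Written this
  way, the dependence on \<open>m\<close> sits in a single binomial.\<close>

definition lcoeff :: "nat \<Rightarrow> nat \<Rightarrow> rat" where
  "lcoeff m k = of_nat ((m + k choose (2 * k)) * (2 * k choose k))"

lemma binomial_Suc_times: "Suc k * (n choose Suc k) = (n - k) * (n choose k)"
proof (cases "k \<le> n")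
  case True
  then show ?thesis
    using binomial_absorb_comp[of n k] Suc_times_binomial[of k "n - 1"]
    by (cases n) auto
next
  case False
  then show ?thesis by (simp add: binomial_eq_0)
qed

lemma of_nat_binomial_Suc:
  "of_nat (Suc k) * of_nat (n choose Suc k) = ((of_nat n - of_nat k) * of_nat (n choose k) :: rat)"
proof (cases "k \<le> n")
  case True
  then show ?thesis
    using arg_cong[OF binomial_Suc_times[of k n], of "of_nat :: nat \<Rightarrow> rat"]
    by (simp only: of_nat_mult of_nat_diff)
next
  case False
  then show ?thesis by (simp add: binomial_eq_0)
qed

lemma of_nat_binomial_Suc_top:
  "(of_nat (Suc n) - of_nat k) * of_nat (Suc n choose k) = (of_nat (Suc n) * of_nat (n choose k) :: rat)"
proof (cases "k \<le> n")
  case True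
  have "Suc n * (n choose k) = (Suc n - k) * (Suc n choose k)"
    using binomial_absorb_comp[of "Suc n" k] by simp
  from arg_cong[OF this, of "of_nat :: nat \<Rightarrow> rat"] True show ?thesis
    by (simp only: of_nat_mult of_nat_diff)
next
  case False
  then show ?thesis by (cases "k = Suc n") (auto simp: binomial_eq_0)
qed

lemma central_binomial_Suc:
  "of_nat (Suc k) * of_nat (2 * Suc k choose Suc k) = (2 * (2 * of_nat k + 1) * of_nat (2 * k choose k) :: rat)"
proof -
  have 1: "of_nat (Suc k) * of_nat (Suc (Suc (2 * k)) choose Suc k)
      = (of_nat (Suc (Suc (2 * k))) * of_nat (Suc (2 * k) choose k) :: rat)"
    using binomial_absorption[of k "Suc (2*k)"] by (metis Suc_times_binomial of_nat_mult)
  have 2: "(of_nat (Suc (2 * k)) - of_nat k) * of_nat (Suc (2 * k) choose k)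
      = (of_nat (Suc (2 * k)) * of_nat (2 * k choose k) :: rat)"
    by (rule of_nat_binomial_Suc_top)
  have "of_nat (Suc k) * of_nat (2 * Suc k choose Suc k)
      = (2 * ((of_nat (Suc (2 * k)) - of_nat k) * of_nat (Suc (2 * k) choose k)) :: rat)"
    using 1 by (simp add: algebra_simps)
  then show ?thesis unfolding 2 by (simp add: algebra_simps)
qed

lemma cbin_0 [simp]: "cbin 0 = 1"
  by (simp add: cbin_def)

lemma cbin_Suc: "2 * of_nat (Suc k) * cbin (Suc k) = (2 * of_nat k + 1) * cbin k"
proof -
  have "2 * of_nat (Suc k) * cbin (Suc k)
      = 2 * (of_nat (Suc k) * of_nat (2 * Suc k choose Suc k)) / 4 ^ Suc k"
    unfolding cbin_def by (simp only: times_divide_eq_right mult.assoc)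
  also have "\<dots> = (2 * of_nat k + 1) * cbin k"
    unfolding central_binomial_Suc by (simp add: cbin_def field_simps)
  finally show ?thesis .
qed

lemma cbin_square: "cbin k ^ 2 = of_nat ((2 * k choose k)\<^sup>2) / 16 ^ k"
  by (simp add: cbin_def power2_eq_square flip: power_mult_distrib)

lemma lcoeff_0 [simp]: "lcoeff m 0 = 1"
  by (simp add: lcoeff_def)

lemma lcoeff_eq_0: "m < k \<Longrightarrow> lcoeff m k = 0"
  by (simp add: lcoeff_def binomial_eq_0)

text \<open>Two absorption steps on the upper binomial, through (m+k+1 choose 2k+1), and one step of
  the central binomial. This is the coefficient recurrence of the Legendre equation.\<close>

lemma lcoeff_Suc_right:
  "of_nat (Suc k) ^ 2 * lcoeff m (Suc k) = (of_nat m - of_nat k) * (of_nat m + of_nat k + 1) * lcoeff m k"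
proof -
  define N where "N = m + k"
  define x y z :: rat where "x = of_nat (N choose (2 * k))" "y = of_nat (Suc N choose Suc (2 * k))"
    "z = of_nat (Suc N choose Suc (Suc (2 * k)))"
  have 1: "of_nat (Suc (2 * k)) * y = of_nat (Suc N) * x"
    unfolding x_y_z_def by (metis Suc_times_binomial of_nat_mult)
  have 2: "of_nat (Suc (Suc (2 * k))) * z = (of_nat (Suc N) - of_nat (Suc (2 * k))) * y"
    unfolding x_y_z_def by (rule of_nat_binomial_Suc)
  define c d :: rat where "c = of_nat (2 * k choose k)" "d = of_nat (2 * Suc k choose Suc k)"
  have 3: "of_nat (Suc k) * d = 2 * (2 * of_nat k + 1) * c"
    unfolding c_d_def by (rule central_binomial_Suc)
  have "of_nat (Suc k) ^ 2 * lcoeff m (Suc k) = of_nat (Suc k) * z * (of_nat (Suc k) * d)"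
    by (simp add: lcoeff_def x_y_z_def c_d_def N_def power2_eq_square)
  also have "\<dots> = (of_nat (Suc (Suc (2 * k))) * z) * (of_nat (Suc (2*k)) * c)"
    unfolding 3 by (simp add: algebra_simps)
  also have "\<dots> = (of_nat m - of_nat k) * (of_nat (Suc (2 * k)) * y) * c"
    unfolding 2 by (simp add: N_def algebra_simps)
  also have "\<dots> = (of_nat m - of_nat k) * (of_nat m + of_nat k + 1) * lcoeff m k"
    unfolding 1 by (simp add: N_def lcoeff_def x_y_z_def c_d_def algebra_simps)
  finally show ?thesis .
qed

lemma lcoeff_Suc_left:
  "(of_nat (Suc m) - of_nat k) * lcoeff (Suc m) k = (of_nat (Suc m) + of_nat k) * lcoeff m k"
proof -
  have "(of_nat (Suc m) - of_nat k) * lcoeff (Suc m) k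
      = (of_nat (Suc (m + k)) - of_nat (2 * k)) * of_nat (Suc (m + k) choose (2 * k)) * of_nat (2 * k choose k)"
    by (simp add: lcoeff_def del: binomial_Suc_Suc)
  then show ?thesis unfolding of_nat_binomial_Suc_top by (simp add: lcoeff_def)
qed

text \<open>The right-hand side is the certificate found by Zeilberger's algorithm.\<close>

lemma watson_sum_telescope:
  fixes t defines "t \<equiv> \<lambda>m k. (-1) ^ k * lcoeff m k * cbin k"
  shows "(\<Sum>i\<le>k. of_nat (m + 2) ^ 2 * t (m + 2) i - of_nat (m + 1) ^ 2 * t m i)
       = of_nat (2 * m + 3) * of_nat (2 * k + 1) * t (m + 1) k"
proof (induction k)
  case 0
  then show ?case by (simp add: t_def power2_eq_square algebra_simps)
next
  case (Suc k)
  define u where "u = lcoeff (m + 1) k"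
  define M K :: rat where "M = of_nat m" "K = of_nat k"
  define s :: rat where "s = (-1) ^ k"
  have K: "K + 1 \<noteq> 0" unfolding M_K_def by (metis of_nat_Suc of_nat_neq_0 add.commute)
  have a: "cbin (Suc k) = (2 * K + 1) / (2 * (K + 1)) * cbin k"
    using cbin_Suc[of k] K by (simp add: M_K_def field_simps)
  have 1: "lcoeff (m + 1) (Suc k) = (M + 1 - K) * (M + K + 2) / (K + 1) ^ 2 * u"
    using lcoeff_Suc_right[of k "m + 1"] K by (simp add: M_K_def u_def field_simps)
  have 2: "lcoeff (m + 2) (Suc k) = (M + K + 3) * (M + K + 2) / (K + 1) ^ 2 * u"
  proof -
    have "(K + 1) ^ 2 * lcoeff (m + 2) (Suc k) = (M + K + 3) * ((M + 2 - K) * lcoeff (m + 2) k)"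
      using lcoeff_Suc_right[of k "m + 2"] by (simp add: M_K_def algebra_simps)
    also have "(M + 2 - K) * lcoeff (m + 2) k = (M + 2 + K) * u"
      using lcoeff_Suc_left[of "m + 1" k] by (simp add: M_K_def u_def algebra_simps)
    finally show ?thesis using K by (simp add: field_simps)
  qed
  have 3: "lcoeff m (Suc k) = (M - K) * (M + 1 - K) / (K + 1) ^ 2 * u"
  proof -
    have "(K + 1) ^ 2 * lcoeff m (Suc k) = (M - K) * ((M + 1 + K) * lcoeff m k)"
      using lcoeff_Suc_right[of k m] by (simp add: M_K_def algebra_simps)
    also have "(M + 1 + K) * lcoeff m k = (M + 1 - K) * u"
      using lcoeff_Suc_left[of m k] by (simp add: M_K_def u_def algebra_simps)
    finally show ?thesis using K by (simp add: field_simps)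
  qed
  define c where "c = s * cbin k * u"
  have t1: "t (m + 1) k = c" by (simp add: t_def s_def c_def u_def)
  \<comment> \<open>The factor common to the three terms at \<open>Suc k\<close>; it holds the only
    denominator. Replacing 2K+1 through \<open>e'\<close> leaves an identity of polynomials in M, K,
    e and c.\<close>
  define e where "e = - ((2 * K + 1) / (2 * (K + 1) ^ 3))"
  have e: "- ((2 * K + 1) / (2 * (K + 1)) / (K + 1) ^ 2) = e"
    by (simp add: e_def power3_eq_cube power2_eq_square)
  have t2: "t (m + 2) (Suc k) = (M + K + 3) * (M + K + 2) * e * c"
    unfolding t_def 2 a c_def by (simp add: s_def e[symmetric] mult_ac)
  have t3: "t m (Suc k) = (M - K) * (M + 1 - K) * e * c"
    unfolding t_def 3 a c_def by (simp add: s_def e[symmetric] mult_ac)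
  have t4: "t (m + 1) (Suc k) = (M + 1 - K) * (M + K + 2) * e * c"
    unfolding t_def 1 a c_def by (simp add: s_def e[symmetric] mult_ac)
  have e': "2 * (K + 1) ^ 3 * e = - (2 * K + 1)"
    using K by (simp add: e_def)
  have c3: "of_nat (2 * m + 3) = 2 * M + 3" "of_nat (2 * k + 1) = 2 * K + 1"
    "of_nat (2 * Suc k + 1) = 2 * K + 3" "of_nat (m + 2) = M + 2" "of_nat (m + 1) = M + 1"
    by (simp_all add: M_K_def)
  have "(\<Sum>i\<le>Suc k. of_nat (m + 2) ^ 2 * t (m + 2) i - of_nat (m + 1) ^ 2 * t m i)
     = (2 * M + 3) * (2 * K + 1) * c + ((M + 2) ^ 2 * ((M + K + 3) * (M + K + 2))
         - (M + 1) ^ 2 * ((M - K) * (M + 1 - K))) * e * c"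
    unfolding sum.atMost_Suc Suc.IH unfolding t1 t2 t3 c3 by (simp add: algebra_simps)
  also have "(2 * M + 3) * (2 * K + 1) * c = - (2 * M + 3) * (2 * (K + 1) ^ 3 * e) * c"
    unfolding e' by (simp add: algebra_simps)
  also have "\<dots> + ((M + 2) ^ 2 * ((M + K + 3) * (M + K + 2))
         - (M + 1) ^ 2 * ((M - K) * (M + 1 - K))) * e * c
     = (2 * M + 3) * (2 * K + 3) * ((M + 1 - K) * (M + K + 2) * e * c)"
    by algebra
  finally show ?case unfolding t4 c3 .
qed

text \<open>At k = m + 2 the right-hand side of the telescoped sum vanishes, because
  \<open>lcoeff (m + 1) (m + 2)\<close> is zero.\<close>

lemma watson_sum_rec:
  fixes E defines "E \<equiv> \<lambda>m. \<Sum>k\<le>m. (-1) ^ k * lcoeff m k * cbin k"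
  shows "of_nat (m + 2) ^ 2 * E (m + 2) = of_nat (m + 1) ^ 2 * E m"
proof -
  have E: "E m = (\<Sum>k\<le>m+2. (-1) ^ k * lcoeff m k * cbin k)"
    unfolding E_def by (rule sum.mono_neutral_left) (auto simp: lcoeff_eq_0)
  have E2: "E (m + 2) = (\<Sum>k\<le>m+2. (-1) ^ k * lcoeff (m + 2) k * cbin k)"
    by (simp only: E_def)
  have "of_nat (m + 2) ^ 2 * E (m + 2) - of_nat (m + 1) ^ 2 * E m = 0"
    using watson_sum_telescope[where k = "m + 2" and m = m]
    unfolding E E2 by (simp add: sum_subtractf sum_distrib_left lcoeff_eq_0 del: sum.atMost_Suc)
  then show ?thesis by simp
qed

text \<open>A terminating case of Watson's 3F2 summation at 1. The recurrence moves \<open>m\<close>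
  by two, so the parities separate and start from the values at 0 and 1.\<close>

lemma watson_sum:
  "(\<Sum>k\<le>2 * j. (-1) ^ k * lcoeff (2 * j) k * cbin k) = cbin j ^ 2"
  "(\<Sum>k\<le>Suc (2 * j). (-1) ^ k * lcoeff (Suc (2 * j)) k * cbin k) = 0"
proof (induction j)
  case 0
  {
    case 1 show ?case by simp
  next
    case 2 show ?case using lcoeff_Suc_right[of 0 1] cbin_Suc[of 0] by simp
  }
next
  case (Suc j)
  {
    case 1
    define J :: rat where "J = of_nat j"
    have J: "J + 1 \<noteq> 0" unfolding J_def by (metis of_nat_Suc of_nat_neq_0 add.commute)
    have "of_nat (2 * j + 2) ^ 2 * (\<Sum>k\<le>2 * j + 2. (-1) ^ k * lcoeff (2 * j + 2) k * cbin k)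
        = ((2 * J + 1) * cbin j) ^ 2"
      unfolding watson_sum_rec Suc.IH by (simp add: J_def power_mult_distrib)
    also have "(2 * J + 1) * cbin j = 2 * (J + 1) * cbin (Suc j)"
      using cbin_Suc[of j] by (simp add: J_def algebra_simps)
    also have "\<dots> ^ 2 = of_nat (2 * j + 2) ^ 2 * cbin (Suc j) ^ 2"
      by (simp add: J_def power_mult_distrib[symmetric] algebra_simps)
    finally show ?case by (simp del: sum.atMost_Suc)
  next
    case 2
    have "of_nat (Suc (2 * j) + 2) ^ 2 *
      (\<Sum>k\<le>Suc (2 * j) + 2. (-1) ^ k * lcoeff (Suc (2 * j) + 2) k * cbin k) = 0"
      unfolding watson_sum_rec Suc.IH by simp
    then show ?case by (simp del: sum.atMost_Suc of_nat_Suc of_nat_add)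
  }
qed

section \<open>The hypergeometric differential operator\<close>

text \<open>Gauss's operator for parameters a, 1-a; 1 with c = -a(1-a). For c = n(n+1) it kills the
  Legendre polynomial at 1 - 2x, for c = -1/4 the series with coefficients
  \<open>cbin k ^ 2\<close>.\<close>

definition hypergeom_op :: "rat \<Rightarrow> rat poly \<Rightarrow> rat poly" where
  "hypergeom_op c y = [:0, 1, -1:] * pderiv (pderiv y) + [:1, -2:] * pderiv y + smult c y"

lemma coeff_hypergeom_op:
  "coeff (hypergeom_op c y) k
     = of_nat (Suc k) ^ 2 * coeff y (Suc k) + (c - of_nat k * of_nat (Suc k)) * coeff y k"
proof -
  have *: "hypergeom_op c y = pCons 0 (pderiv (pderiv y)) - pCons 0 (pCons 0 (pderiv (pderiv y)))
      + pderiv y - smult 2 (pCons 0 (pderiv y)) + smult c y"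
    by (simp add: hypergeom_op_def algebra_simps)
  show ?thesis
  proof (cases k)
    case 0
    then show ?thesis by (simp add: * coeff_pderiv)
  next
    case (Suc j)
    then show ?thesis
      by (cases j) (simp_all add: * coeff_pderiv algebra_simps power2_eq_square)
  qed
qed

lemma hypergeom_op_add: "hypergeom_op c (y + z) = hypergeom_op c y + hypergeom_op c z"
  by (simp add: hypergeom_op_def pderiv_add algebra_simps smult_add_right)

text \<open>Under x -> 1-x the factor x(1-x) is fixed, while 1-2x and the first derivative both
  change sign.\<close>

lemma hypergeom_op_reflect:
  "hypergeom_op c (pcompose y [:1, -1:]) = pcompose (hypergeom_op c y) [:1, -1:]"
proof -
  let ?R = "[:1, -1:] :: rat poly"
  have d: "pderiv (pcompose q ?R) = - pcompose (pderiv q) ?R" for q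
    by (simp add: pderiv_pcompose pderiv_pCons)
  have "pcompose [:0, 1, -1:] ?R = [:0, 1, -1:]" "pcompose [:1, -2:] ?R = - [:1, -2:]"
    by (simp_all add: pcompose_pCons)
  then show ?thesis
    unfolding hypergeom_op_def d pderiv_minus pcompose_add pcompose_mult pcompose_smult by simp
qed

text \<open>Lagrange's identity: the operator is self-adjoint, being (x(1-x)y')' + cy.\<close>

lemma pderiv_wronskian:
  "pderiv ([:0, 1, -1:] * (y * pderiv z - pderiv y * z))
     = y * hypergeom_op c z - z * hypergeom_op d y + smult (d - c) (y * z)"
proof -
  have s: "smult e q = [:e:] * q" for e :: rat and q by simp
  have m: "[:d - c:] = [:d:] - [:c:]" by simp
  have q: "pderiv [:0, 1, -1 :: rat:] = [:1, -2:]" by (simp add: pderiv_pCons)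
  show ?thesis
    unfolding hypergeom_op_def s m pderiv_mult pderiv_diff q by algebra
qed

text \<open>This is the classical Legendre polynomial evaluated at 1 - 2x.\<close>

definition legendre :: "nat \<Rightarrow> rat poly" where
  "legendre n = (\<Sum>k\<le>n. monom ((-1) ^ k * lcoeff n k) k)"

lemma coeff_legendre: "coeff (legendre n) k = (-1) ^ k * lcoeff n k"
  by (simp add: legendre_def coeff_sum lcoeff_eq_0)

lemma hypergeom_op_legendre: "hypergeom_op (of_nat (n * Suc n)) (legendre n) = 0"
proof (rule poly_eqI)
  fix k
  have "coeff (hypergeom_op (of_nat (n * Suc n)) (legendre n)) k
      = (-1) ^ k * ((of_nat (n * Suc n) - of_nat k * of_nat (Suc k)) * lcoeff n k
          - of_nat (Suc k) ^ 2 * lcoeff n (Suc k))"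
    unfolding coeff_hypergeom_op coeff_legendre by (simp add: algebra_simps)
  also have "\<dots> = 0" unfolding lcoeff_Suc_right by (simp add: algebra_simps)
  finally show "coeff (hypergeom_op (of_nat (n * Suc n)) (legendre n)) k = coeff 0 k" by simp
qed

text \<open>The equation gives a first-order recurrence with leading factor (k+1)^2, never zero, so
  the constant term determines the solution.\<close>

lemma hypergeom_op_eq_0_imp:
  assumes "hypergeom_op (of_nat (n * Suc n)) y = 0"
  shows "y = smult (coeff y 0) (legendre n)"
proof (rule poly_eqI)
  fix k
  show "coeff y k = coeff (smult (coeff y 0) (legendre n)) k"
  proof (induction k)
    case 0
    then show ?case by (simp add: coeff_legendre)
  next
    case (Suc k)
    let ?c = "of_nat (n * Suc n) :: rat" and ?z = "smult (coeff y 0) (legendre n)"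
    have "hypergeom_op ?c ?z = smult (coeff y 0) (hypergeom_op ?c (legendre n))"
      by (simp add: hypergeom_op_def pderiv_smult smult_add_right mult.commute)
    then have "coeff (hypergeom_op ?c y) k = coeff (hypergeom_op ?c ?z) k"
      using assms hypergeom_op_legendre[of n] by simp
    then have "of_nat (Suc k) ^ 2 * coeff y (Suc k) = of_nat (Suc k) ^ 2 * coeff ?z (Suc k)"
      unfolding coeff_hypergeom_op Suc.IH by (simp only: add_right_cancel)
    then show ?case by (simp del: of_nat_Suc)
  qed
qed

lemma degree_legendre: "degree (legendre n) = n"
proof (rule antisym)
  show "degree (legendre n) \<le> n"
    by (rule degree_le) (simp add: coeff_legendre lcoeff_eq_0)
  have "lcoeff n n \<noteq> 0" by (simp add: lcoeff_def mult_2)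
  then show "n \<le> degree (legendre n)"
    by (intro le_degree) (simp add: coeff_legendre)
qed

text \<open>The reflected polynomial solves the same equation, hence is a multiple of
  \<open>legendre n\<close>; the leading coefficients give the factor.\<close>

lemma legendre_reflect: "pcompose (legendre n) [:1, -1:] = smult ((-1) ^ n) (legendre n)"
proof -
  let ?y = "pcompose (legendre n) [:1, -1:]"
  have y: "?y = smult (coeff ?y 0) (legendre n)"
    by (rule hypergeom_op_eq_0_imp) (simp only: hypergeom_op_reflect hypergeom_op_legendre pcompose_0)
  have "lead_coeff ?y = lead_coeff (legendre n) * (-1) ^ n"
    by (subst lead_coeff_comp) (simp_all add: degree_legendre)
  moreover have "lead_coeff ?y = coeff ?y 0 * lead_coeff (legendre n)"
    using arg_cong[OF y, of lead_coeff] by (simp only: lead_coeff_smult)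
  moreover have "lead_coeff (legendre n) \<noteq> 0"
    using coeff_legendre[of n 0] by (auto simp: leading_coeff_0_iff)
  ultimately have c: "coeff ?y 0 = (-1) ^ n" by simp
  show ?thesis using y unfolding c .
qed

lemma poly_legendre_0 [simp]: "poly (legendre n) 0 = 1"
  by (simp add: poly_0_coeff_0 coeff_legendre)

lemma poly_legendre_1: "poly (legendre n) 1 = (-1) ^ n"
  using arg_cong[OF legendre_reflect[of n], of "\<lambda>q. poly q 0"] by (simp add: poly_pcompose)

text \<open>Trades the denominator \<open>k\<close> for one independent of the summation index; this
  makes \<open>sum_lcoeff_over_k\<close> and \<open>landen_sum\<close> computable.\<close>

lemma lcoeff_diff:
  assumes "k \<ge> 1"
  shows "(lcoeff (Suc m) k - lcoeff m k) / of_nat k = (lcoeff (Suc m) k + lcoeff m k) / of_nat (Suc m)"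
proof -
  have "of_nat (Suc m) * (lcoeff (Suc m) k - lcoeff m k) = of_nat k * (lcoeff (Suc m) k + lcoeff m k)"
    using lcoeff_Suc_left[of m k] by (simp only: algebra_simps)
  then show ?thesis using assms by (simp add: divide_simps algebra_simps del: of_nat_Suc)
qed

text \<open>By \<open>lcoeff_diff\<close>, raising \<open>n\<close> by one adds Legendre values at
  1, less their constant terms, over n+1. The two consecutive values cancel, which leaves
  -2/(n+1).\<close>

lemma sum_lcoeff_over_k:
  "(\<Sum>k=1..n. (-1) ^ k * lcoeff n k / of_nat k) = - 2 * (\<Sum>k=1..n. 1 / of_nat k)"
proof (induction n)
  case 0
  then show ?case by simp
next
  case (Suc n)
  have s: "(\<Sum>k=1..N. (-1) ^ k * lcoeff m k) = (-1) ^ m - 1" if "m \<le> N" for m N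
  proof -
    have "(\<Sum>k=1..N. (-1) ^ k * lcoeff m k) = (\<Sum>k=1..m. (-1) ^ k * lcoeff m k)"
      using that by (intro sum.mono_neutral_right) (auto simp: lcoeff_eq_0)
    moreover have "(\<Sum>k\<le>m. (-1) ^ k * lcoeff m k) = (-1) ^ m"
      using poly_legendre_1[of m] by (simp add: poly_altdef degree_legendre coeff_legendre)
    moreover have "(\<Sum>k\<le>m. (-1) ^ k * lcoeff m k) = 1 + (\<Sum>k=1..m. (-1) ^ k * lcoeff m k)"
      by (simp add: atMost_atLeast0 sum.atLeast_Suc_atMost)
    ultimately show ?thesis by simp
  qed
  have e: "(\<Sum>k=1..Suc n. (-1) ^ k * lcoeff n k / of_nat k) = (\<Sum>k=1..n. (-1) ^ k * lcoeff n k / of_nat k)"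
    by (simp add: lcoeff_eq_0)
  have "(\<Sum>k=1..Suc n. (-1) ^ k * lcoeff (Suc n) k / of_nat k)
      - (\<Sum>k=1..Suc n. (-1) ^ k * lcoeff n k / of_nat k)
      = (\<Sum>k=1..Suc n. (-1) ^ k * ((lcoeff (Suc n) k - lcoeff n k) / of_nat k))"
    unfolding sum_subtractf[symmetric] by (intro sum.cong) (auto simp: diff_divide_distrib algebra_simps)
  also have "\<dots> = (\<Sum>k=1..Suc n. (-1) ^ k * ((lcoeff (Suc n) k + lcoeff n k) / of_nat (Suc n)))"
    by (intro sum.cong refl) (simp only: lcoeff_diff atLeastAtMost_iff)
  also have "\<dots> = ((\<Sum>k=1..Suc n. (-1) ^ k * lcoeff (Suc n) k) + (\<Sum>k=1..Suc n. (-1) ^ k * lcoeff n k)) / of_nat (Suc n)"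
    unfolding sum.distrib[symmetric] sum_divide_distrib by (intro sum.cong) (auto simp: algebra_simps)
  also have "\<dots> = - 2 / of_nat (Suc n)" unfolding s[OF order.refl] s[OF le_SucI[OF order.refl]] by simp
  finally show ?case unfolding e Suc.IH by (simp add: algebra_simps)
qed

section \<open>The truncated series F and its defect in the differential equation\<close>

definition trunc_series :: "nat \<Rightarrow> rat poly" where
  "trunc_series N = (\<Sum>k<N. monom (cbin k ^ 2) k)"

lemma coeff_trunc_series: "coeff (trunc_series N) k = (if k < N then cbin k ^ 2 else 0)"
  by (simp add: trunc_series_def coeff_sum)

lemma poly_trunc_series: "poly (trunc_series N) x = (\<Sum>k<N. cbin k ^ 2 * x ^ k)"
  by (simp add: trunc_series_def poly_sum poly_monom)

lemma cbin_square_Suc: "of_nat (Suc k) ^ 2 * cbin (Suc k) ^ 2 = (of_nat k + 1 / 2) ^ 2 * cbin k ^ 2"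
proof -
  have "of_nat (Suc k) * cbin (Suc k) = (of_nat k + 1 / 2) * cbin k"
    using cbin_Suc[of k] by (simp add: field_simps)
  then show ?thesis by (metis power_mult_distrib)
qed

text \<open>The full series is annihilated; the cut leaves only what the last coefficient would pass
  on to the missing next one. The factor comes from -1/4 - k(k+1) = -(k + 1/2)^2.\<close>

lemma hypergeom_op_trunc_series:
  "hypergeom_op (- 1 / 4) (trunc_series (Suc N)) = - monom ((of_nat N + 1 / 2) ^ 2 * cbin N ^ 2) N"
proof (rule poly_eqI)
  fix k
  have "coeff (hypergeom_op (- 1 / 4) (trunc_series (Suc N))) k
     = of_nat (Suc k) ^ 2 * coeff (trunc_series (Suc N)) (Suc k)
       - (of_nat k + 1 / 2) ^ 2 * coeff (trunc_series (Suc N)) k"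
    unfolding coeff_hypergeom_op by (simp add: power2_eq_square field_simps)
  then show "coeff (hypergeom_op (- 1 / 4) (trunc_series (Suc N))) k
      = coeff (- monom ((of_nat N + 1 / 2) ^ 2 * cbin N ^ 2) N) k"
    using cbin_square_Suc[of k] by (auto simp: coeff_trunc_series)
qed

section \<open>Harmonic sums modulo a prime\<close>

text \<open>The real parts of i^m and of i^k (1+i)^N.\<close>

definition re_i_pow :: "nat \<Rightarrow> rat" where
  "re_i_pow m = (if even m then (-1) ^ (m div 2) else 0)"

definition re_gauss :: "nat \<Rightarrow> nat \<Rightarrow> rat" where
  "re_gauss N k = (\<Sum>r\<le>N. of_nat (N choose r) * re_i_pow (k + r))"

lemma re_i_pow_add2: "re_i_pow (Suc (Suc m)) = - re_i_pow m"
  by (simp add: re_i_pow_def)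

lemma re_gauss_Suc: "re_gauss (Suc N) k = re_gauss N k + re_gauss N (Suc k)"
proof -
  let ?g = "\<lambda>r. re_i_pow (k + r)"
  have "re_gauss (Suc N) k = ?g 0 + (\<Sum>r\<le>N. of_nat (N choose Suc r) * ?g (Suc r))
      + (\<Sum>r\<le>N. of_nat (N choose r) * ?g (Suc r))"
    unfolding re_gauss_def sum.atMost_Suc_shift by (simp add: sum.distrib algebra_simps)
  also have "?g 0 + (\<Sum>r\<le>N. of_nat (N choose Suc r) * ?g (Suc r))
      = (\<Sum>r\<le>Suc N. of_nat (N choose r) * ?g r)"
    unfolding sum.atMost_Suc_shift by simp
  also have "\<dots> = re_gauss N k" by (simp add: re_gauss_def binomial_eq_0)
  finally show ?thesis by (simp add: re_gauss_def)
qed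

text \<open>This is (1+i)^2 = 2i.\<close>

lemma re_gauss_add2: "re_gauss (N + 2) k = 2 * re_gauss N (Suc k)"
proof -
  have "re_gauss N (Suc (Suc k)) = - re_gauss N k"
    by (simp add: re_gauss_def re_i_pow_add2 sum_negf)
  then show ?thesis by (simp add: re_gauss_Suc)
qed

lemma re_gauss_shift: "2 ^ k * re_gauss N k = re_gauss (N + 2 * k) 0"
proof (induction k arbitrary: N)
  case (Suc k)
  have "2 ^ Suc k * re_gauss N (Suc k) = 2 ^ k * re_gauss (N + 2) k"
    unfolding re_gauss_add2 by simp
  also have "\<dots> = re_gauss (N + 2 + 2 * k) 0" by (rule Suc.IH)
  finally show ?case by (simp add: add.commute)
qed simp

text \<open>Here (1+i)^(4j+3) = (-4)^j (-2+2i); squaring the real part removes the sign.\<close>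

lemma re_gauss_square: "re_gauss (4 * j + 3) 0 ^ 2 = 2 ^ (4 * j + 2)"
proof -
  have "re_gauss (4 * j + 3) 0 = - 2 * (- 4) ^ j"
  proof (induction j)
    case 0
    then show ?case by (simp add: re_gauss_def re_i_pow_def numeral_3_eq_3)
  next
    case (Suc j)
    have "re_gauss (4 * Suc j + 3) 0 = 4 * re_gauss (4 * j + 3) 2"
      using re_gauss_shift[of 2 "4 * j + 3"] by simp
    also have "re_gauss (4 * j + 3) 2 = - re_gauss (4 * j + 3) 0"
      by (simp add: re_gauss_def re_i_pow_add2 sum_negf)
    finally show ?case using Suc.IH by simp
  qed
  moreover have "((- 4 :: rat) ^ j) ^ 2 = 16 ^ j"
    by (simp add: power2_eq_square flip: power_mult_distrib)
  moreover have "(2 :: rat) ^ (4 * j + 2) = 4 * 16 ^ j"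
    by (simp add: power_add power_mult)
  ultimately show ?thesis by (simp only: power_mult_distrib) simp
qed

lemma sum_re_i_pow: "(\<Sum>m\<le>2 * n. re_i_pow m * g m) = (\<Sum>j\<le>n. (-1) ^ j * g (2 * j))"
  by (induction n) (simp_all add: re_i_pow_def)

context
  fixes p :: nat
  assumes p: "prime p"
begin

lemma pmult_cong_mult:
  assumes "pmult p m (x - x')" "pmult p m (y - y')" "pmult p 0 x'" "pmult p 0 y"
  shows "pmult p m (x * y - x' * y')"
proof -
  have "x * y - x' * y' = (x - x') * y + x' * (y - y')" by (simp add: algebra_simps)
  then show ?thesis
    using pmult_add[OF p pmult_mult_right[OF p assms(1,4)] pmult_mult_left[OF p assms(3,2)]] by simp
qed

text \<open>Modulo p the upper entry p - s acts as -s, and (-s choose r) = (-1)^r (s+r-1 choose r).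
  The bound r < p keeps the divisors prime to p.\<close>

lemma binomial_neg_cong:
  assumes "s \<ge> 1" "s \<le> p" "r < p"
  shows "pmult p 1 (of_nat (p - s choose r) - (-1) ^ r * of_nat (s + r - 1 choose r))"
  using assms(3)
proof (induction r)
  case 0
  then show ?case by (simp add: p)
next
  case (Suc r)
  define y z :: rat where "y = of_nat (p - s choose r)" "z = (-1) ^ r * of_nat (s + r - 1 choose r)"
  have y: "of_nat (Suc r) * of_nat (p - s choose Suc r) = (of_nat p - of_nat s - of_nat r) * y"
    unfolding y_z_def of_nat_binomial_Suc using assms by (simp add: of_nat_diff)
  have "of_nat (Suc r) * of_nat (s + r choose Suc r) = (of_nat s * of_nat (s + r choose r) :: rat)"
    unfolding of_nat_binomial_Suc by simp
  also have "\<dots> = of_nat (s + r) * of_nat (s + r - 1 choose r)"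
    using of_nat_binomial_Suc_top[of "s + r - 1" r] assms by simp
  finally have w: "of_nat (Suc r) * of_nat (s + Suc r - 1 choose Suc r)
      = (of_nat (s + r) * of_nat (s + r - 1 choose r) :: rat)"
    by simp
  have z: "of_nat (Suc r) * ((-1) ^ Suc r * of_nat (s + Suc r - 1 choose Suc r)) = - (of_nat s + of_nat r) * z"
    unfolding mult.left_commute[of "of_nat (Suc r)"] w y_z_def by (simp add: algebra_simps)
  have "of_nat (Suc r) * (of_nat (p - s choose Suc r) - (-1) ^ Suc r * of_nat (s + Suc r - 1 choose Suc r))
      = - (of_nat (s + r)) * (y - z) + of_nat p * y"
    unfolding right_diff_distrib y z by (simp add: algebra_simps)
  also have "pmult p 1 \<dots>"
  proof (rule pmult_add[OF p])
    have "pmult p 1 (y - z)" using Suc unfolding y_z_def by simp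
    then show "pmult p 1 (- of_nat (s + r) * (y - z))"
      by (rule pmult_mult_left[OF p pmult_minus[OF p pmult_of_nat[OF p]]])
    show "pmult p 1 (of_nat p * y)"
      unfolding y_z_def by (rule pmult_mult_right[OF p pmult_p[OF p] pmult_of_nat[OF p]])
  qed
  finally show ?case
    by (rule pmult_cancel_nat[OF p]) (use Suc.prems in \<open>auto dest: dvd_imp_le\<close>)
qed

text \<open>From (p choose m)/p = (p-1 choose m-1)/m and the preceding congruence at s = 1.\<close>

lemma binomial_prime_cong:
  assumes "1 \<le> m" "m < p"
  shows "pmult p 1 (of_nat (p choose m) / of_nat p - (-1) ^ (m - 1) / of_nat m)"
proof -
  have "m * (p choose m) = p * (p - 1 choose (m - 1))"
    using Suc_times_binomial[of "m - 1" "p - 1"] assms by simp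
  from arg_cong[OF this, of "of_nat :: nat \<Rightarrow> rat"]
  have "of_nat (p choose m) / of_nat p = (of_nat (p - 1 choose (m - 1)) / of_nat m :: rat)"
    using assms by (simp add: field_simps)
  then have "of_nat (p choose m) / of_nat p - (-1) ^ (m - 1) / of_nat m
     = 1 / of_nat m * (of_nat (p - 1 choose (m - 1)) - (-1) ^ (m - 1) :: rat)"
    by (simp add: diff_divide_distrib)
  moreover have "pmult p 1 (of_nat (p - 1 choose (m - 1)) - (-1) ^ (m - 1))"
    using binomial_neg_cong[of 1 "m - 1"] assms by simp
  moreover have "pmult p 0 (1 / of_nat m)"
    using assms by (intro pmult_inverse_nat p) (auto dest: dvd_imp_le)
  ultimately show ?thesis using pmult_mult_left[OF p] by metis
qed

end

lemma alternating_harmonic: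
  "(\<Sum>m=1..2*n. (-1) ^ m / of_nat m) = (\<Sum>m=1..n. 1 / of_nat m) - (\<Sum>m=1..2*n. 1 / of_nat m :: rat)"
proof (induction n)
  case (Suc n)
  have e: "{1..2 * Suc n} = insert (2*n+2) (insert (2*n+1) {1..2*n})" by auto
  have "(\<Sum>m=1..2*Suc n. f m) = (\<Sum>m=1..2*n. f m) + f (2*n+1) + f (2*n+2)" for f :: "nat \<Rightarrow> rat"
    unfolding e by simp
  moreover have "1 + of_nat n \<noteq> (0 :: rat)" by (metis of_nat_Suc of_nat_neq_0)
  then have "2 / (2 + 2 * of_nat n) = 1 / (1 + of_nat n :: rat)" by (simp add: field_simps)
  ultimately show ?case using Suc by simp
qed simp

context
  fixes p n :: nat
  assumes p: "prime p" and pn: "p = 2 * n + 1"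
begin

lemma not_dvd_small: "0 < k \<Longrightarrow> k < p \<Longrightarrow> \<not> p dvd k"
  by (auto dest: dvd_imp_le)

lemma not_dvd_2: "\<not> p dvd 2"
proof
  assume "p dvd 2"
  then have "p = 2" using prime_ge_2_nat[OF p] by (auto dest: dvd_imp_le)
  then show False using pn by presburger
qed

lemma pmult_half: "pmult p 0 (1 / 2)"
  using pmult_inverse_nat[OF p not_dvd_2] by simp

text \<open>Pair m with p-m, as 1/m + 1/(p-m) = p/(m(p-m)).\<close>

lemma harmonic_prime: "pmult p 1 (\<Sum>m=1..2*n. 1 / of_nat m)"
proof -
  let ?H = "\<Sum>m=1..2*n. 1 / of_nat m :: rat"
  have "?H = (\<Sum>m=1..2*n. 1 / of_nat (p - m))"
    by (rule sum.reindex_bij_witness[of _ "\<lambda>m. p - m" "\<lambda>m. p - m"]) (auto simp: pn)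
  then have "2 * ?H = (\<Sum>m=1..2*n. 1 / of_nat m + 1 / of_nat (p - m))"
    by (simp add: sum.distrib)
  also have "\<dots> = (\<Sum>m=1..2*n. of_nat p * (1 / of_nat m * (1 / of_nat (p - m))))"
    by (intro sum.cong refl) (auto simp: pn field_simps of_nat_diff)
  also have "pmult p 1 \<dots>"
    by (intro pmult_sum pmult_mult_right pmult_mult_left pmult_p pmult_inverse_nat p not_dvd_small)
      (auto simp: pn)
  finally have "pmult p 1 (2 * ?H)" .
  from pmult_mult_left[OF p pmult_half this] show ?thesis by simp
qed

text \<open>Expand (1+1)^p, divide by p, and apply \<open>binomial_prime_cong\<close> term by
  term.\<close>

lemma fermat_quotient_harmonic:
  "pmult p 1 ((2 ^ p - 2) / of_nat p + (\<Sum>m=1..n. 1 / of_nat m))"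
proof -
  let ?H = "\<lambda>N. \<Sum>m=1..N. 1 / of_nat m :: rat"
  have "(2 :: nat) ^ p = (\<Sum>m\<le>p. p choose m)" by (simp add: choose_row_sum)
  also have "{..p} = insert 0 (insert p {1..2*n})" using pn by auto
  also have "(\<Sum>m\<in>\<dots>. p choose m) = 2 + (\<Sum>m=1..2*n. p choose m)" using pn by simp
  finally have "(of_nat (2 ^ p) :: rat) = of_nat (2 + (\<Sum>m=1..2*n. p choose m))" by simp
  then have "(2 ^ p - 2) / of_nat p = (\<Sum>m=1..2*n. of_nat (p choose m) / of_nat p :: rat)"
    by (simp add: sum_divide_distrib)
  moreover have "pmult p 1 ((\<Sum>m=1..2*n. of_nat (p choose m) / of_nat p) - (\<Sum>m=1..2*n. (-1) ^ (m - 1) / of_nat m))"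
    unfolding sum_subtractf[symmetric] by (intro pmult_sum binomial_prime_cong p) (auto simp: pn)
  moreover have "(\<Sum>m=1..2*n. (-1) ^ (m - 1) / of_nat m) = - (\<Sum>m=1..2*n. (-1) ^ m / of_nat m :: rat)"
    unfolding sum_negf[symmetric]
  proof (intro sum.cong refl)
    fix m assume "m \<in> {1..2*n}"
    then show "(-1) ^ (m - 1) / of_nat m = - ((-1) ^ m / of_nat m :: rat)"
      by (cases m) simp_all
  qed
  ultimately have "pmult p 1 ((2 ^ p - 2) / of_nat p - - (?H n - ?H (2 * n)))"
    by (simp only: alternating_harmonic)
  from pmult_add[OF p this harmonic_prime] show ?thesis by simp
qed

text \<open>The same for the real part of (1+i)^p. Since p is odd, i^p has real part 0 and only 1
  stays outside the sum; the surviving indices m = 2j account for the factor 1/2.\<close>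

lemma re_gauss_cong:
  "pmult p 1 ((re_gauss p 0 - 1) / of_nat p + (\<Sum>j=1..n. (-1) ^ j / of_nat j) / 2)"
proof -
  have "re_gauss p 0 = (\<Sum>m\<in>insert 0 (insert p {1..2*n}). of_nat (p choose m) * re_i_pow m)"
    unfolding re_gauss_def using pn by (intro sum.cong) auto
  also have "\<dots> = 1 + (\<Sum>m=1..2*n. of_nat (p choose m) * re_i_pow m)"
    using pn by (simp add: re_i_pow_def)
  finally have 1: "(re_gauss p 0 - 1) / of_nat p = (\<Sum>m=1..2*n. of_nat (p choose m) / of_nat p * re_i_pow m)"
    by (simp add: sum_divide_distrib)
  have "pmult p 1 ((\<Sum>m=1..2*n. of_nat (p choose m) / of_nat p * re_i_pow m)
      - (\<Sum>m=1..2*n. (-1) ^ (m - 1) / of_nat m * re_i_pow m))"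
    unfolding sum_subtractf[symmetric] left_diff_distrib[symmetric]
  proof (intro pmult_sum pmult_mult_right binomial_prime_cong p)
    show "pmult p 0 (re_i_pow m)" for m
      using pmult_of_int[OF p, of "(-1) ^ (m div 2)"] by (simp add: re_i_pow_def p)
  qed (auto simp: pn)
  moreover have "(\<Sum>m=1..2*n. (-1) ^ (m - 1) / of_nat m * re_i_pow m)
      = (\<Sum>m\<le>2*n. re_i_pow m * (- 1 / of_nat m))"
    by (rule sum.mono_neutral_cong_left) (auto simp: re_i_pow_def)
  moreover have "\<dots> = (\<Sum>j=1..n. (-1) ^ j * (- 1 / of_nat (2 * j)))"
    unfolding sum_re_i_pow by (rule sum.mono_neutral_right) auto
  moreover have "\<dots> = - (\<Sum>j=1..n. (-1) ^ j / of_nat j) / 2"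
    unfolding sum_divide_distrib sum_negf[symmetric] by (intro sum.cong) auto
  ultimately show ?thesis unfolding 1 by simp
qed

lemma re_gauss_cong_1: "pmult p 1 (re_gauss p 0 - 1)"
proof -
  let ?G = "\<Sum>j=1..n. (-1) ^ j / of_nat j :: rat"
  have G: "pmult p 0 (?G / 2)"
  proof -
    have "pmult p 0 ((-1) ^ j * (1 / of_nat j))" if "j \<in> {1..n}" for j
      using pmult_of_int[OF p, of "(-1) ^ j"] that pn
      by (intro pmult_mult_left p pmult_inverse_nat not_dvd_small) auto
    then have "pmult p 0 ?G" by (intro pmult_sum p) simp
    from pmult_mult_right[OF p this pmult_half] show ?thesis by simp
  qed
  have "pmult p 0 ((re_gauss p 0 - 1) / of_nat p + ?G / 2)"
    using pmult_mono[OF p re_gauss_cong] by simp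
  from pmult_mult_left[OF p pmult_diff[OF p this G] pmult_p[OF p]]
  show ?thesis using prime_gt_0_nat[OF p] by (simp add: mult.commute)
qed

text \<open>For p = 4j + 3 one has 2^p = 2r^2 with r the real part of (1+i)^p. As r is 1 modulo p,
  (2^p-2)/p = 2(r^2-1)/p agrees with 4(r-1)/p modulo p.\<close>

lemma fermat_quotient_alternating:
  assumes "odd n"
  shows "pmult p 1 ((2 ^ p - 2) / of_nat p + 2 * (\<Sum>j=1..n. (-1) ^ j / of_nat j))"
proof -
  let ?G = "\<Sum>j=1..n. (-1) ^ j / of_nat j :: rat" and ?r = "re_gauss p 0"
  obtain j where "n = 2 * j + 1" using assms by (auto elim: oddE)
  then have p4: "p = 4 * j + 3" using pn by simp
  have "(2 :: rat) ^ p = 2 * 2 ^ (4 * j + 2)" unfolding p4 by (simp add: power_add)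
  also have "(2 :: rat) ^ (4 * j + 2) = ?r ^ 2" unfolding p4 re_gauss_square ..
  finally have "(2 ^ p - 2) / of_nat p = 4 * ((?r - 1) / of_nat p) + 2 * ((?r - 1) * ((?r - 1) / of_nat p))"
    using prime_gt_0_nat[OF p] by (simp add: field_simps power2_eq_square)
  then have "(2 ^ p - 2) / of_nat p + 2 * ?G
      = 4 * ((?r - 1) / of_nat p + ?G / 2) + 2 * ((?r - 1) * ((?r - 1) / of_nat p))"
    by simp
  moreover have "pmult p 1 \<dots>"
  proof (rule pmult_add[OF p pmult_mult_left[OF p pmult_numeral[OF p] re_gauss_cong]
        pmult_mult_left[OF p pmult_numeral[OF p] pmult_mult_right[OF p re_gauss_cong_1]]])
    show "pmult p 0 ((?r - 1) / of_nat p)"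
      using re_gauss_cong_1 unfolding pmult_def by simp
  qed
  ultimately show ?thesis by (simp only:)
qed

text \<open>The coefficient ratios have numerators (k+1/2)^2 and (k+1/2)^2 - (n+1/2)^2, which differ
  by p^2/4. For n < k < p this makes \<open>cbin k ^ 2\<close> divisible by p^2.\<close>

lemma cbin_square_cong:
  assumes "k < p"
  shows "pmult p 2 (cbin k ^ 2 - (-1) ^ k * lcoeff n k)"
  using assms
proof (induction k)
  case 0
  then show ?case by (simp add: p)
next
  case (Suc k)
  define c l :: rat where "c = cbin k ^ 2" "l = (-1) ^ k * lcoeff n k"
  have P: "of_nat p = (2 * of_nat n + 1 :: rat)" by (simp add: pn)
  have "of_nat (4 * Suc k ^ 2) * (cbin (Suc k) ^ 2 - (-1) ^ Suc k * lcoeff n (Suc k))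
      = 4 * (of_nat (Suc k) ^ 2 * cbin (Suc k) ^ 2) + 4 * (-1) ^ k * (of_nat (Suc k) ^ 2 * lcoeff n (Suc k))"
    by (simp add: algebra_simps)
  also have "\<dots> = of_nat ((2 * k + 1) ^ 2) * (c - l) + of_nat p ^ 2 * l"
    unfolding cbin_square_Suc lcoeff_Suc_right P c_l_def
    by (simp add: power2_eq_square field_simps)
  also have "pmult p 2 \<dots>"
  proof (intro pmult_add[OF p] pmult_mult_left[OF p pmult_of_nat[OF p]]
      pmult_mult_right[OF p pmult_p_power[OF p]])
    show "pmult p 2 (c - l)" using Suc unfolding c_l_def by simp
    show "pmult p 0 l"
      using pmult_of_int[OF p, of "(-1) ^ k * int ((n + k choose (2 * k)) * (2 * k choose k))"]
      unfolding c_l_def lcoeff_def by simp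
  qed
  finally show ?case
  proof (rule pmult_cancel_nat[OF p])
    have "\<not> p dvd 2" "\<not> p dvd Suc k"
      using not_dvd_2 not_dvd_small[of "Suc k"] Suc.prems by auto
    moreover have "4 * Suc k ^ 2 = 2 * 2 * (Suc k * Suc k)" by (simp add: power2_eq_square)
    ultimately show "\<not> p dvd 4 * Suc k ^ 2" using p by (simp only: prime_dvd_mult_iff) simp
  qed
qed

lemma pmult_cbin_square: "pmult p 0 (cbin k ^ 2)"
proof -
  have "\<not> p dvd 16 ^ k"
  proof
    assume "p dvd 16 ^ k"
    then have "p dvd 2 ^ (4 * k)" by (simp add: power_mult)
    then show False using p prime_dvd_power not_dvd_2 by blast
  qed
  from pmult_mult_left[OF p pmult_of_nat[OF p, of "(2 * k choose k)\<^sup>2"] pmult_inverse_nat[OF p this]]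
  show ?thesis unfolding cbin_square by simp
qed

end

section \<open>Landen's transformation modulo a prime\<close>

text \<open>Pascal's rule makes the binomial a difference of (m+1+k choose 2k) and (m+k choose 2k);
  \<open>lcoeff_diff\<close> then removes the 1/k.\<close>

lemma landen_coeff:
  assumes "1 \<le> k" "k \<le> Suc m"
  shows "cbin k ^ 2 * 4 ^ k / of_nat k * ((-1) ^ k * of_nat (Suc m + k - 1 choose (Suc m - k)))
    = ((-1) ^ k * lcoeff (Suc m) k * cbin k + (-1) ^ k * lcoeff m k * cbin k) / of_nat (Suc m)"
proof -
  define i where "i = 2 * k - 1"
  have i: "2 * k = Suc i" "i \<le> m + k" "m + k - i = Suc m - k"
    using assms by (auto simp: i_def)
  have "Suc m + k - 1 choose (Suc m - k) = m + k choose i"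
    using binomial_symmetric[OF i(2)] unfolding i(3) by simp
  moreover have "(Suc m + k choose (2 * k)) = (m + k choose i) + (m + k choose (2 * k))"
    unfolding i(1) by (simp only: add_Suc binomial_Suc_Suc)
  ultimately have "of_nat (Suc m + k - 1 choose (Suc m - k)) * of_nat (2 * k choose k)
      = lcoeff (Suc m) k - lcoeff m k"
    unfolding lcoeff_def by (simp add: algebra_simps del: binomial_Suc_Suc)
  moreover have "cbin k ^ 2 * 4 ^ k = cbin k * of_nat (2 * k choose k)"
    by (simp add: cbin_def power2_eq_square)
  ultimately have "cbin k ^ 2 * 4 ^ k / of_nat k * ((-1) ^ k * of_nat (Suc m + k - 1 choose (Suc m - k)))
      = (-1) ^ k * cbin k * ((lcoeff (Suc m) k - lcoeff m k) / of_nat k)"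
    by (simp add: mult_ac)
  also have "\<dots> = (-1) ^ k * cbin k * ((lcoeff (Suc m) k + lcoeff m k) / of_nat (Suc m))"
    unfolding lcoeff_diff[OF assms(1)] ..
  finally show ?thesis by (simp add: algebra_simps add_divide_distrib)
qed

text \<open>Two Watson sums of opposite parity are added: \<open>cbin j ^ 2\<close> from index 2j,
  zero from 2j-1. The -2 drops their terms at k = 0.\<close>

lemma landen_sum:
  assumes "j \<ge> 1"
  shows "(\<Sum>k=1..2*j. cbin k ^ 2 * 4 ^ k / of_nat k * ((-1) ^ k * of_nat (2 * j + k - 1 choose (2 * j - k))))
    = (cbin j ^ 2 - 2) / of_nat (2 * j)"
proof -
  obtain i where i: "j = Suc i" using assms by (cases j) auto
  define m where "m = Suc (2 * i)"
  have m: "2 * j = Suc m" by (simp add: i m_def)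
  let ?t = "\<lambda>m k. (-1) ^ k * lcoeff m k * cbin k"
  have a: "(\<Sum>k\<le>Suc m. ?t N k) = 1 + (\<Sum>k=1..Suc m. ?t N k)" for N
    by (simp add: atMost_atLeast0 sum.atLeast_Suc_atMost del: sum.cl_ivl_Suc)
  have "(\<Sum>k\<le>Suc m. ?t (Suc m) k) = cbin j ^ 2"
    using watson_sum(1)[of j] unfolding m .
  moreover have "(\<Sum>k\<le>Suc m. ?t m k) = (\<Sum>k\<le>m. ?t m k)"
    by (simp add: lcoeff_eq_0)
  moreover have "(\<Sum>k\<le>m. ?t m k) = 0"
    using watson_sum(2)[of i] unfolding m_def .
  ultimately have s: "(\<Sum>k=1..Suc m. ?t (Suc m) k) + (\<Sum>k=1..Suc m. ?t m k) = cbin j ^ 2 - 2"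
    unfolding a by linarith
  have "(\<Sum>k=1..Suc m. cbin k ^ 2 * 4 ^ k / of_nat k * ((-1) ^ k * of_nat (Suc m + k - 1 choose (Suc m - k))))
      = (\<Sum>k=1..Suc m. (?t (Suc m) k + ?t m k) / of_nat (Suc m))"
    by (intro sum.cong refl landen_coeff) auto
  also have "\<dots> = (cbin j ^ 2 - 2) / of_nat (Suc m)"
    unfolding sum_divide_distrib[symmetric] sum.distrib s ..
  finally show ?thesis unfolding m .
qed

context
  fixes p n :: nat
  assumes p: "prime p" and pn: "p = 2 * n + 1"
begin

lemma pmult_minus1_power: "pmult p 0 ((-1) ^ k)"
  using pmult_of_int[OF p, of "(-1) ^ k"] by simp

lemma pmult_lcoeff: "pmult p 0 (lcoeff m k)"
  unfolding lcoeff_def by (rule pmult_of_nat[OF p])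

lemma pmult_inverse_small: "0 < k \<Longrightarrow> k < p \<Longrightarrow> pmult p 0 (1 / of_nat k)"
  by (intro pmult_inverse_nat[OF p] not_dvd_small[OF p pn])

text \<open>
The left-hand sum is the coefficient of r^(2j) in (1+r)^p Q(4r / (1+r)^2), the right-hand side the
one in Q(r^2) / 2 + 2 log(1+r), the logarithm being truncated.
\<close>

lemma landen_inner_cong:
  assumes "1 \<le> j" "j \<le> n"
  shows "pmult p 1 ((\<Sum>k=1..n. cbin k ^ 2 * 4 ^ k / of_nat k *
      (if k \<le> 2 * j then of_nat (p - 2 * k choose (2 * j - k)) else 0)) - (cbin j ^ 2 - 2) / of_nat (2 * j))"
proof -
  define m where "m = 2 * j"
  let ?w = "\<lambda>k. cbin k ^ 2 * 4 ^ k / of_nat k"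
  \<comment> \<open>Both sums are stretched to k \<le> 2n for a termwise comparison: the left one
    stops at n, that of \<open>landen_sum\<close> at m, which may exceed n.\<close>
  let ?u = "\<lambda>k. if k \<le> n \<and> k \<le> m then ?w k * of_nat (p - 2 * k choose (m - k)) else 0"
  let ?v = "\<lambda>k. if k \<le> m then ?w k * ((-1) ^ k * of_nat (m + k - 1 choose (m - k))) else 0"
  have w: "pmult p 0 (4 ^ k / of_nat k)" if "1 \<le> k" "k \<le> 2 * n" for k
    using pmult_mult_left[OF p pmult_0_power[OF p pmult_numeral[OF p]] pmult_inverse_small[of k]]
      that pn by simp
  have "pmult p 1 (?u k - ?v k)" if k: "k \<in> {1..2*n}" for k
  proof (cases "k \<le> m")
    case True
    show ?thesis
    proof (cases "k \<le> n")
      case kn: True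
      have "pmult p 1 (of_nat (p - 2 * k choose (m - k))
          - (-1) ^ (m - k) * of_nat (2 * k + (m - k) - 1 choose (m - k)))"
        by (rule binomial_neg_cong[OF p]) (use k kn pn assms m_def in auto)
      moreover have "2 * k + (m - k) - 1 = m + k - 1" using True by simp
      moreover have "(-1) ^ (m - k) = ((-1) ^ k :: rat)"
        using True by (simp add: m_def minus_one_power_iff)
      moreover have "pmult p 0 (?w k)"
        using pmult_mult_left[OF p pmult_cbin_square[OF p pn] w, of k k] k by simp
      ultimately have "pmult p 1 (?w k * (of_nat (p - 2 * k choose (m - k))
          - (-1) ^ k * of_nat (m + k - 1 choose (m - k))))"
        by (intro pmult_mult_left[OF p]) (simp_all only:)
      then show ?thesis using True kn by (simp add: right_diff_distrib)
    next
      case False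
      \<comment> \<open>Here only \<open>?v\<close> has a term, and it is divisible by p since
        \<open>lcoeff n k\<close> is zero.\<close>
      have "pmult p 1 (cbin k ^ 2)"
        using pmult_mono[OF p cbin_square_cong[OF p pn, of k], of 1] False k pn
        by (simp add: lcoeff_eq_0)
      then have "pmult p 1 (cbin k ^ 2 * (4 ^ k / of_nat k *
          ((-1) ^ k * of_nat (m + k - 1 choose (m - k)))))"
        using k by (intro pmult_mult_right[OF p] pmult_0_mult[OF p] w pmult_minus1_power pmult_of_nat[OF p]) auto
      from pmult_minus[OF p this] show ?thesis using True False by (simp add: mult.assoc)
    qed
  qed (simp add: p)
  then have "pmult p 1 (\<Sum>k=1..2*n. ?u k - ?v k)" by (rule pmult_sum[OF p])
  moreover have "(\<Sum>k=1..2*n. ?u k)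
      = (\<Sum>k=1..n. ?w k * (if k \<le> m then of_nat (p - 2 * k choose (m - k)) else 0))"
    by (rule sum.mono_neutral_cong_right) auto
  moreover have "(\<Sum>k=1..2*n. ?v k) = (\<Sum>k=1..m. ?w k * ((-1) ^ k * of_nat (m + k - 1 choose (m - k))))"
    by (rule sum.mono_neutral_cong_right) (use assms m_def in auto)
  ultimately show ?thesis
    using landen_sum[OF assms(1)] unfolding m_def by (simp only: sum_subtractf)
qed

text \<open>The index becomes the full exponent m = k + r, over a range independent of
  \<open>k\<close>, so that a double sum over k and m can be interchanged.\<close>

lemma re_gauss_expand:
  assumes "1 \<le> k" "k \<le> n"
  shows "re_gauss (p - 2 * k) k
    = (\<Sum>m\<le>2*n. re_i_pow m * (if k \<le> m then of_nat (p - 2 * k choose (m - k)) else 0))"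
proof -
  have "re_gauss (p - 2 * k) k = (\<Sum>m=k..p-k. re_i_pow m * of_nat (p - 2 * k choose (m - k)))"
    unfolding re_gauss_def
    by (rule sum.reindex_bij_witness[of _ "\<lambda>m. m - k" "\<lambda>r. k + r"]) (use assms pn in auto)
  also have "\<dots> = (\<Sum>m\<le>2*n. re_i_pow m * (if k \<le> m then of_nat (p - 2 * k choose (m - k)) else 0))"
    by (rule sum.mono_neutral_cong_left) (use assms pn in \<open>auto simp: binomial_eq_0\<close>)
  finally show ?thesis .
qed

text \<open>Real part at r = i of the congruence behind \<open>landen_inner_cong\<close>: there
  4r/(1+r)^2 = 2 and r^2 = -1, and the prefactor (1+i)^p has real part 1 modulo p.\<close>

lemma landen_cong:
  fixes Q defines "Q \<equiv> \<lambda>x. \<Sum>k=1..n. cbin k ^ 2 * x ^ k / of_nat k"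
  shows "pmult p 1 (2 * Q 2 - Q (-1) + 2 * (\<Sum>j=1..n. (-1) ^ j / of_nat j))"
proof -
  let ?r = "re_gauss p 0"
  let ?w = "\<lambda>k. cbin k ^ 2 * 4 ^ k / of_nat k"
  let ?b = "\<lambda>m k. if k \<le> m then of_nat (p - 2 * k choose (m - k)) else 0 :: rat"
  let ?g = "\<lambda>m. \<Sum>k=1..n. ?w k * ?b m k"
  \<comment> \<open>Since 2^k i^k = (1+i)^(2k), the product (1+i)^p Q(2) is the sum of
    \<open>?w k\<close> i^k (1+i)^(p-2k), polynomial in i because 2k < p.\<close>
  have "?r * Q 2 = (\<Sum>k=1..n. ?w k * re_gauss (p - 2 * k) k)"
    unfolding Q_def sum_distrib_left
  proof (intro sum.cong refl)
    fix k assume k: "k \<in> {1..n}"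
    then have "p - 2 * k + 2 * k = p" using pn by simp
    then have "?r = 2 ^ k * re_gauss (p - 2 * k) k" using re_gauss_shift[of k "p - 2 * k"] by simp
    moreover have "(4 :: rat) ^ k = 2 ^ k * 2 ^ k" by (simp flip: power_mult_distrib)
    ultimately show "?r * (cbin k ^ 2 * 2 ^ k / of_nat k) = ?w k * re_gauss (p - 2 * k) k"
      by simp
  qed
  also have "\<dots> = (\<Sum>k=1..n. \<Sum>m\<le>2*n. re_i_pow m * (?w k * ?b m k))"
  proof (intro sum.cong refl)
    fix k assume k: "k \<in> {1..n}"
    show "?w k * re_gauss (p - 2 * k) k = (\<Sum>m\<le>2*n. re_i_pow m * (?w k * ?b m k))"
      using k by (subst re_gauss_expand) (auto simp only: sum_distrib_left mult.left_commute atLeastAtMost_iff)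
  qed
  also have "\<dots> = (\<Sum>m\<le>2*n. re_i_pow m * ?g m)"
    unfolding sum_distrib_left by (rule sum.swap)
  also have "\<dots> = (\<Sum>j\<le>n. (-1) ^ j * ?g (2 * j))" by (rule sum_re_i_pow)
  also have "\<dots> = (\<Sum>j=1..n. (-1) ^ j * ?g (2 * j))"
    by (rule sum.mono_neutral_right) auto
  finally have 1: "?r * Q 2 = \<dots>" .
  have "pmult p 1 ((\<Sum>j=1..n. (-1) ^ j * ?g (2 * j)) - (\<Sum>j=1..n. (-1) ^ j * ((cbin j ^ 2 - 2) / of_nat (2 * j))))"
    unfolding sum_subtractf[symmetric] right_diff_distrib[symmetric]
    by (intro pmult_sum[OF p] pmult_mult_left[OF p] pmult_minus1_power landen_inner_cong) auto
  moreover have "(\<Sum>j=1..n. (-1) ^ j * ((cbin j ^ 2 - 2) / of_nat (2 * j)))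
      = Q (-1) / 2 - (\<Sum>j=1..n. (-1) ^ j / of_nat j)"
    unfolding Q_def sum_divide_distrib sum_subtractf[symmetric]
    by (intro sum.cong refl) (simp add: field_simps)
  ultimately have 2: "pmult p 1 (?r * Q 2 - (Q (-1) / 2 - (\<Sum>j=1..n. (-1) ^ j / of_nat j)))"
    unfolding 1 by simp
  have "pmult p 0 (cbin k ^ 2 * (2 ^ k * (1 / of_nat k)))" if "k \<in> {1..n}" for k
    using that pn
    by (intro pmult_0_mult[OF p] pmult_cbin_square[OF p pn] pmult_0_power[OF p] pmult_numeral[OF p]
        pmult_inverse_small) auto
  then have "pmult p 0 (Q 2)" unfolding Q_def by (intro pmult_sum[OF p]) simp
  from pmult_mult_right[OF p re_gauss_cong_1[OF p pn] this]
  have "pmult p 1 (2 * (?r * Q 2 - (Q (-1) / 2 - (\<Sum>j=1..n. (-1) ^ j / of_nat j)) - (?r - 1) * Q 2))"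
    by (rule pmult_mult_left[OF p pmult_numeral[OF p] pmult_diff[OF p 2]])
  then show ?thesis by (simp add: algebra_simps)
qed

end

section \<open>The Wronskian argument\<close>

definition poly_pmult :: "nat \<Rightarrow> nat \<Rightarrow> rat poly \<Rightarrow> bool" where
  "poly_pmult p m q \<longleftrightarrow> (\<forall>k. pmult p m (coeff q k))"

lemma coeff_eq_poly_pcompose: "coeff (pcompose q [:a, 1:]) 0 = poly q (a :: rat)"
  by (simp add: poly_pcompose flip: poly_0_coeff_0)

context
  fixes p :: nat
  assumes p: "prime p"
begin

lemma poly_pmult_add: "poly_pmult p m q \<Longrightarrow> poly_pmult p m r \<Longrightarrow> poly_pmult p m (q + r)"
  by (simp add: poly_pmult_def pmult_add[OF p])

lemma poly_pmult_mult: "poly_pmult p i q \<Longrightarrow> poly_pmult p j r \<Longrightarrow> poly_pmult p (i + j) (q * r)"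
  by (auto simp: poly_pmult_def coeff_mult intro!: pmult_sum[OF p] pmult_mult[OF p])

lemma poly_pmult_pderiv: "poly_pmult p m q \<Longrightarrow> poly_pmult p m (pderiv q)"
  unfolding poly_pmult_def coeff_pderiv by (auto intro!: pmult_mult_left[OF p] simp del: of_nat_Suc simp: p)

lemma poly_pmult_pcompose:
  assumes "poly_pmult p m q" "poly_pmult p 0 r"
  shows "poly_pmult p m (pcompose q r)"
  using assms(1)
proof (induction q)
  case 0
  then show ?case by simp
next
  case (pCons a q)
  have "pmult p m (coeff (pCons a q) (Suc k))" for k
    using pCons.prems unfolding poly_pmult_def by blast
  then have q: "poly_pmult p m q" by (simp add: poly_pmult_def)
  have "pmult p m (coeff (pCons a q) 0)" using pCons.prems unfolding poly_pmult_def by blast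
  then have a: "poly_pmult p m [:a:]"
    by (simp add: poly_pmult_def coeff_pCons p split: nat.split)
  have "poly_pmult p m (r * pcompose q r)"
    using poly_pmult_mult[OF assms(2) pCons.IH[OF q]] by simp
  then show ?case unfolding pcompose_pCons by (rule poly_pmult_add[OF a])
qed

lemma pmult_poly: "poly_pmult p m q \<Longrightarrow> pmult p 0 x \<Longrightarrow> pmult p m (poly q x)"
  unfolding poly_altdef poly_pmult_def
  by (intro pmult_sum[OF p] pmult_mult_right[OF p] pmult_0_power[OF p]) auto

lemma pmult_cancel_unit:
  assumes "pmult p m (u * x)" "pmult p 0 u" "\<not> pmult p 1 u"
  shows "pmult p m x"
proof -
  obtain a b where ab: "u = of_int a / of_int b" "\<not> int p dvd b"
    using assms(2) by (auto simp: pmult_0_iff[OF p] p_integral_iff[OF p])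
  have a: "\<not> int p dvd a"
    using assms(3) pmult_mult_right[OF p _ pmult_inverse[OF p ab(2)], of 1 "of_int a"] ab(1)
    by (auto simp: pmult_1_of_int[OF p, simplified])
  have "of_int a * x = of_int b * (u * x)" using ab by auto
  then have "pmult p m (of_int a * x)"
    using pmult_mult_left[OF p pmult_of_int[OF p, of b] assms(1)] by (simp only:)
  then show ?thesis using a by (rule pmult_cancel[OF p])
qed

end

text \<open>For s > 0, the antiderivative, zero at 0, of x^(s-1) times the Legendre polynomial. With
  s = p = 2n + 1 only the term k = 0 has a denominator divisible by p.\<close>

definition legendre_moment :: "nat \<Rightarrow> nat \<Rightarrow> rat poly" where
  "legendre_moment n s = (\<Sum>k\<le>n. monom ((-1) ^ k * lcoeff n k / of_nat (k + s)) (k + s))"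

lemma pderiv_legendre_moment:
  "pderiv (legendre_moment n (Suc s)) = legendre n * monom 1 s"
proof -
  have pderiv_sum: "pderiv (sum f A) = (\<Sum>x\<in>A. pderiv (f x))" for f :: "nat \<Rightarrow> rat poly" and A
    using higher_pderiv_sum[of 1 f A] by simp
  have "pderiv (legendre_moment n (Suc s)) = (\<Sum>k\<le>n. monom ((-1) ^ k * lcoeff n k) k * monom 1 s)"
    unfolding legendre_moment_def pderiv_sum
    by (intro sum.cong refl) (simp add: pderiv_monom mult_monom del: of_nat_Suc of_nat_add)
  then show ?thesis by (simp add: legendre_def sum_distrib_right)
qed

lemma poly_legendre_moment:
  "poly (legendre_moment n s) x = (\<Sum>k\<le>n. (-1) ^ k * lcoeff n k / of_nat (k + s) * x ^ (k + s))"
  by (simp add: legendre_moment_def poly_sum poly_monom)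

section \<open>The Legendre polynomial at -1 and the integral modulo p\<close>

context
  fixes p n :: nat
  assumes p: "prime p" and pn: "p = 2 * n + 1" and n: "odd n"
begin

lemma poly_pmult_legendre: "poly_pmult p 0 (legendre n)"
  unfolding poly_pmult_def coeff_legendre
  by (auto intro: pmult_0_mult[OF p] pmult_minus1_power[OF p pn] pmult_lcoeff[OF p pn])

lemma poly_pmult_reflect: "poly_pmult p 0 [:1, -1:]"
  using pmult_minus[OF p pmult_1[OF p]]
  by (simp add: poly_pmult_def coeff_pCons p split: nat.split)

text \<open>From 2n+1 = p one gets n+k+1 = -(n-k) modulo p, so the coefficient ratio becomes
  -(n-k)^2/(k+1)^2, that of the signed squares.\<close>

lemma lcoeff_cong: "k \<le> n \<Longrightarrow> pmult p 1 (lcoeff n k - (-1) ^ k * of_nat (n choose k) ^ 2)"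
proof (induction k)
  case 0
  then show ?case by (simp add: p)
next
  case (Suc k)
  define l z N K :: rat where "l = lcoeff n k" "z = (-1) ^ k * of_nat (n choose k) ^ 2"
    "N = of_nat n" "K = of_nat k"
  note d = l_z_N_K_def
  have P: "of_nat p = 2 * N + 1" by (simp add: pn d)
  have b: "of_nat (Suc k) ^ 2 * of_nat (n choose Suc k) ^ 2 = (N - K) ^ 2 * (of_nat (n choose k) ^ 2 :: rat)"
    unfolding power_mult_distrib[symmetric] of_nat_binomial_Suc d ..
  have "of_nat (Suc k ^ 2) * (lcoeff n (Suc k) - (-1) ^ Suc k * of_nat (n choose Suc k) ^ 2)
      = of_nat (Suc k) ^ 2 * lcoeff n (Suc k) + (-1) ^ k * (of_nat (Suc k) ^ 2 * of_nat (n choose Suc k) ^ 2)"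
    by (simp add: algebra_simps)
  also have "of_nat (Suc k) ^ 2 * lcoeff n (Suc k) = (N - K) * (N + K + 1) * l"
    unfolding lcoeff_Suc_right d ..
  also have "(-1) ^ k * (of_nat (Suc k) ^ 2 * of_nat (n choose Suc k) ^ 2) = (N - K) ^ 2 * z"
    unfolding b by (simp add: d)
  also have "(N - K) * (N + K + 1) * l + (N - K) ^ 2 * z
      = of_nat p * ((N - K) * l) - (N - K) ^ 2 * (l - z)"
    unfolding P by (simp add: power2_eq_square algebra_simps)
  also have "\<dots> = of_nat p * (of_nat (n - k) * l) - of_nat ((n - k) ^ 2) * (l - z)"
    unfolding d using Suc.prems by (simp add: of_nat_diff)
  also have "pmult p 1 \<dots>"
  proof (rule pmult_diff[OF p pmult_mult_right[OF p pmult_p[OF p]] pmult_mult_left[OF p pmult_of_nat[OF p]]])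
    show "pmult p 0 (of_nat (n - k) * l)"
      unfolding d by (intro pmult_0_mult[OF p] pmult_of_nat[OF p] pmult_lcoeff[OF p pn])
    show "pmult p 1 (l - z)" using Suc unfolding d by simp
  qed
  finally show ?case
  proof (rule pmult_cancel_nat[OF p])
    show "\<not> p dvd Suc k ^ 2"
      using not_dvd_small[OF p pn, of "Suc k"] Suc.prems pn p prime_dvd_power by auto
  qed
qed

text \<open>Modulo p the value is the alternating sum of squared binomials, which changes sign under
  k -> n-k because n is odd.\<close>

lemma poly_legendre_minus1: "pmult p 1 (poly (legendre n) (-1))"
proof -
  let ?f = "\<lambda>k. (-1) ^ k * of_nat (n choose k) ^ 2 :: rat"
  have "(\<Sum>k\<le>n. ?f k) = (\<Sum>k\<le>n. ?f (n - k))"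
    by (rule sum.reindex_bij_witness[of _ "\<lambda>k. n - k" "\<lambda>k. n - k"]) auto
  also have "\<dots> = (\<Sum>k\<le>n. - ?f k)"
  proof (intro sum.cong refl)
    fix k assume "k \<in> {..n}"
    then show "?f (n - k) = - ?f k"
      using n binomial_symmetric[of k n] by (auto simp: minus_one_power_iff)
  qed
  finally have "(\<Sum>k\<le>n. ?f k) = 0" by (simp add: sum_negf)
  moreover have "poly (legendre n) (-1) = (\<Sum>k\<le>n. lcoeff n k)"
    unfolding poly_altdef degree_legendre coeff_legendre
    by (intro sum.cong refl) (simp add: mult_ac flip: power_mult_distrib)
  moreover have "pmult p 1 ((\<Sum>k\<le>n. lcoeff n k) - (\<Sum>k\<le>n. ?f k))"
    unfolding sum_subtractf[symmetric] by (intro pmult_sum[OF p] lcoeff_cong) simp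
  ultimately show ?thesis by simp
qed

text \<open>
Otherwise the differential equation, read off at the ordinary point -1, would force all Taylor
coefficients at -1 to vanish modulo p, contradicting the value 1 at the point 0.
\<close>

lemma poly_pderiv_legendre_minus1: "\<not> pmult p 1 (poly (pderiv (legendre n)) (-1))"
proof
  assume d: "pmult p 1 (poly (pderiv (legendre n)) (-1))"
  let ?S = "[:-1, 1:] :: rat poly"
  define g where "g = pcompose (legendre n) ?S"
  define c :: rat where "c = of_nat (n * Suc n)"
  have pd: "pderiv (pcompose q ?S) = pcompose (pderiv q) ?S" for q
    by (simp add: pderiv_pcompose pderiv_pCons)
  have "pcompose (hypergeom_op c (legendre n)) ?S = 0"
    unfolding c_def hypergeom_op_legendre by simp
  moreover have "pcompose [:0, 1, -1:] ?S = [:-2, 3, -1:]" "pcompose [:1, -2:] ?S = [:3, -2:]"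
    by (simp_all add: pcompose_pCons)
  ultimately have "[:-2, 3, -1:] * pderiv (pderiv g) + [:3, -2:] * pderiv g + smult c g = 0"
    unfolding hypergeom_op_def g_def pd pcompose_add pcompose_mult pcompose_smult by simp
  then have z: "coeff ([:-2, 3, -1:] * pderiv (pderiv g) + [:3, -2:] * pderiv g + smult c g) j = 0" for j
    by (simp only: coeff_0)
  \<comment> \<open>Recurrence for the Taylor coefficients at -1. The leading factor comes from the
    value -2 of x(1-x) there and is prime to p while j + 2 < p.\<close>
  have rec: "of_nat (2 * ((j + 2) * (j + 1))) * coeff g (j + 2)
      = 3 * of_nat (j + 1) ^ 2 * coeff g (j + 1) + (c - of_nat j * of_nat (j + 1)) * coeff g j" for j
  proof (cases j)
    case 0
    then show ?thesis using z[of j] by (simp add: coeff_pderiv algebra_simps numeral_2_eq_2)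
  next
    case (Suc i)
    then show ?thesis
      using z[of j] by (cases i) (simp_all add: coeff_pderiv power2_eq_square algebra_simps numeral_2_eq_2)
  qed
  have "pmult p 1 (coeff g j) \<and> pmult p 1 (coeff g (j + 1))" if "j \<le> n" for j
    using that
  proof (induction j)
    case 0
    have "coeff g 0 = poly (legendre n) (-1)" unfolding g_def by (rule coeff_eq_poly_pcompose)
    moreover have "coeff g 1 = coeff (pderiv g) 0" by (simp add: coeff_pderiv)
    then have "coeff g 1 = poly (pderiv (legendre n)) (-1)"
      unfolding g_def pd coeff_eq_poly_pcompose .
    ultimately show ?case using d poly_legendre_minus1 by simp
  next
    case (Suc j)
    then have IH: "pmult p 1 (coeff g j)" "pmult p 1 (coeff g (j + 1))" by simp_all
    have c': "c - of_nat j * of_nat (j + 1) = of_int (int (n * Suc n) - int (j * (j + 1)))"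
      by (simp add: c_def algebra_simps)
    have "pmult p 1 (of_nat (2 * ((j + 2) * (j + 1))) * coeff g (j + 2))"
      unfolding rec c' mult.assoc
      by (intro pmult_add[OF p] pmult_mult_left[OF p pmult_of_int[OF p] IH(1)]
         pmult_mult_left[OF p pmult_numeral[OF p] pmult_mult_left[OF p pmult_0_power[OF p pmult_of_nat[OF p]] IH(2)]])
    then have "pmult p 1 (coeff g (j + 2))"
    proof (rule pmult_cancel_nat[OF p])
      have "\<not> p dvd j + 2" "\<not> p dvd j + 1"
        using not_dvd_small[OF p pn, of "j + 2"] not_dvd_small[OF p pn, of "j + 1"] Suc.prems pn
        by simp_all
      then show "\<not> p dvd 2 * ((j + 2) * (j + 1))"
        using not_dvd_2[OF p pn] p by (simp only: prime_dvd_mult_iff) simp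
    qed
    then show ?case using IH by simp
  qed
  then have "pmult p 1 (\<Sum>j\<le>n. coeff g j)" by (intro pmult_sum[OF p]) simp
  moreover have "degree g = n" by (simp add: g_def degree_pcompose degree_legendre)
  then have "(\<Sum>j\<le>n. coeff g j) = poly g 1" by (simp add: poly_altdef)
  moreover have "poly g 1 = 1" by (simp add: g_def poly_pcompose)
  ultimately have "pmult p 1 (of_int 1)" by simp
  then have "int p dvd 1" unfolding pmult_1_of_int[OF p] .
  then show False using prime_gt_1_nat[OF p] by simp
qed

text \<open>As P(1-x) = -P(x), the integral of P(x) (x^(p-1) + (1-x)^(p-1)) from 0 to -1 is A(-1) +
  A(2) - A(0) - A(1), where A(0) = 0.\<close>

lemma legendre_moment_cong:
  defines "A \<equiv> legendre_moment n p"
  shows "pmult p 1 (poly A (-1) + poly A 2 - poly A 1)"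
proof -
  let ?l = "\<lambda>k. (-1) ^ k * lcoeff n k"
  let ?G = "\<Sum>j=1..n. (-1) ^ j / of_nat j :: rat" and ?H = "\<Sum>j=1..n. 1 / of_nat j :: rat"
  let ?T = "(2 ^ p - 2) / of_nat p :: rat"
  define Q where "Q x = (\<Sum>k=1..n. cbin k ^ 2 * x ^ k / of_nat k)" for x :: rat
  let ?u = "\<lambda>k. ?l k / of_nat (k + p) * ((-1) ^ (k + p) + 2 ^ (k + p) - 1)"
  have "odd p" using pn by simp
  have T: "pmult p 0 ?T"
  proof -
    have "pmult p 0 ?H" using pn by (intro pmult_sum[OF p] pmult_inverse_small[OF p pn]) auto
    moreover have "pmult p 0 (?T + ?H)"
      using fermat_quotient_harmonic[OF p pn] by (rule pmult_mono[OF p]) simp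
    ultimately show ?thesis using pmult_diff[OF p] by fastforce
  qed
  have "pmult p 1 (of_nat p * ?T)" by (rule pmult_mult_right[OF p pmult_p[OF p] T])
  then have two: "pmult p 1 (2 ^ p - 2)" using prime_gt_0_nat[OF p] by simp
  have "poly A (-1) + poly A 2 - poly A 1 = (\<Sum>k\<le>n. ?u k)"
    unfolding A_def poly_legendre_moment sum.distrib[symmetric] sum_subtractf[symmetric]
    by (intro sum.cong refl) (simp only: distrib_left right_diff_distrib power_one)
  \<comment> \<open>The term k = 0 is split off as the only one with denominator p; it is the Fermat
    quotient T exactly.\<close>
  also have "\<dots> = ?u 0 + (\<Sum>k=1..n. ?u k)"
    by (simp add: atMost_atLeast0 sum.atLeast_Suc_atMost)
  also have "?u 0 = ?T" using \<open>odd p\<close> by simp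
  finally have 1: "poly A (-1) + poly A 2 - poly A 1 = ?T + (\<Sum>k=1..n. ?u k)" .
  have "pmult p 1 (?u k - (2 * (cbin k ^ 2 * 2 ^ k / of_nat k) - cbin k ^ 2 * (-1) ^ k / of_nat k - ?l k / of_nat k))"
    if k: "k \<in> {1..n}" for k
  proof -
    \<comment> \<open>\<open>e - 1\<close> is the last factor of \<open>?u k\<close> modulo p: 2^p
      becomes 2 and (-1)^p is -1.\<close>
    define e :: rat where "e = 2 * 2 ^ k - (-1) ^ k"
    have k': "0 < k" "k < p" using k pn by auto
    have i: "pmult p 0 (1 / of_nat k)" by (rule pmult_inverse_small[OF p pn k'])
    have ii: "pmult p 0 (1 / of_nat (k + p))"
      using not_dvd_small[OF p pn k'] by (intro pmult_inverse_nat[OF p]) simp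
    have e0: "pmult p 0 e"
      unfolding e_def by (intro pmult_diff[OF p] pmult_0_mult[OF p] pmult_0_power[OF p]
        pmult_numeral[OF p] pmult_minus1_power[OF p pn])
    have l0: "pmult p 0 (?l k)"
      by (intro pmult_0_mult[OF p] pmult_minus1_power[OF p pn] pmult_lcoeff[OF p pn])
    have "1 / of_nat (k + p) - 1 / of_nat k = - (of_nat p * (1 / of_nat k * (1 / of_nat (k + p))) :: rat)"
      using k' by (simp add: field_simps)
    then have d1: "pmult p 1 (1 / of_nat (k + p) - 1 / of_nat k)"
      by (simp only:) (intro pmult_minus[OF p] pmult_mult_right[OF p pmult_p[OF p]] pmult_0_mult[OF p] i ii)
    have "(-1) ^ (k + p) + 2 ^ (k + p) - 1 - (e - 1) = 2 ^ k * (2 ^ p - 2 :: rat)"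
      using \<open>odd p\<close> by (simp add: e_def power_add algebra_simps)
    then have d2: "pmult p 1 ((-1) ^ (k + p) + 2 ^ (k + p) - 1 - (e - 1))"
      by (simp only:) (intro pmult_mult_left[OF p pmult_0_power[OF p pmult_numeral[OF p]] two])
    have x0: "pmult p 0 ((-1) ^ (k + p) + 2 ^ (k + p) - 1)"
      by (intro pmult_diff[OF p] pmult_add[OF p] pmult_0_power[OF p]
        pmult_numeral[OF p] pmult_minus1_power[OF p pn] pmult_1[OF p])
    have d3: "pmult p 1 (?l k - cbin k ^ 2)"
      using pmult_minus[OF p pmult_mono[OF p cbin_square_cong[OF p pn k'(2)], of 1]] by simp
    have "pmult p 1 (1 / of_nat (k + p) * ((-1) ^ (k + p) + 2 ^ (k + p) - 1) - 1 / of_nat k * (e - 1))"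
      by (rule pmult_cong_mult[OF p d1 d2 i x0])
    from pmult_mult_left[OF p l0 this]
    have "pmult p 1 (?u k - ?l k * (e - 1) / of_nat k)" by (simp add: right_diff_distrib diff_divide_distrib)
    \<comment> \<open>Only the part with \<open>e\<close> passes to \<open>cbin k ^ 2\<close>, as
      \<open>Q\<close> requires; the part with -1 keeps \<open>?l k\<close>, whose sum over k is
      known exactly.\<close>
    moreover have "pmult p 1 ((?l k - cbin k ^ 2) * (e * (1 / of_nat k)))"
      by (intro pmult_mult_right[OF p d3] pmult_0_mult[OF p] e0 i)
    ultimately have "pmult p 1 (?u k - ?l k * (e - 1) / of_nat k + (?l k - cbin k ^ 2) * (e * (1 / of_nat k)))"
      by (rule pmult_add[OF p])
    moreover have "?u k - ?l k * (e - 1) / of_nat k + (?l k - cbin k ^ 2) * (e * (1 / of_nat k))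
      = ?u k - (2 * (cbin k ^ 2 * 2 ^ k / of_nat k) - cbin k ^ 2 * (-1) ^ k / of_nat k - ?l k / of_nat k)"
    proof -
      have "- x * (e - 1) / r + (x - y) * (e * (1 / r)) = - (2 * (y * 2 ^ k / r) - y * (-1) ^ k / r - x / r)"
        if "r \<noteq> 0" for x y r :: rat
        using that unfolding e_def by (simp add: field_simps)
      from this[of "of_nat k" "?l k" "cbin k ^ 2"] k' show ?thesis by simp
    qed
    ultimately show ?thesis by (simp only:)
  qed
  then have "pmult p 1 (\<Sum>k=1..n. ?u k - (2 * (cbin k ^ 2 * 2 ^ k / of_nat k) - cbin k ^ 2 * (-1) ^ k / of_nat k - ?l k / of_nat k))"
    by (rule pmult_sum[OF p])
  then have 2: "pmult p 1 ((\<Sum>k=1..n. ?u k) - (2 * Q 2 - Q (-1) - (- 2 * ?H)))"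
    unfolding Q_def sum_subtractf sum_distrib_left[symmetric] sum_lcoeff_over_k .
  have 3: "pmult p 1 (2 * Q 2 - Q (-1) + 2 * ?G)"
    using landen_cong[OF p pn] unfolding Q_def .
  have 4: "pmult p 1 (2 * (?T + ?H))"
    by (rule pmult_mult_left[OF p pmult_numeral[OF p] fermat_quotient_harmonic[OF p pn]])
  \<comment> \<open>Landen's congruence leaves -2G, the harmonic one turns 2H into -2T, and T = -2G
    modulo p makes everything cancel.\<close>
  have "pmult p 1 ((\<Sum>k=1..n. ?u k) - (2 * Q 2 - Q (-1) - (- 2 * ?H)) + (2 * Q 2 - Q (-1) + 2 * ?G)
      + 2 * (?T + ?H) - (?T + 2 * ?G))"
    by (intro pmult_diff[OF p] pmult_add[OF p _ 4] pmult_add[OF p 2 3] fermat_quotient_alternating[OF p pn n])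
  moreover have "u - (x - y - (- 2 * h)) + (x - y + 2 * g) + 2 * (t + h) - (t + 2 * g) = t + u"
    for u x y h g t :: rat by simp
  ultimately show ?thesis unfolding 1 by (simp only:)
qed

end

section \<open>The Wronskian and the congruence modulo p^3\<close>

context
  fixes p n :: nat
  assumes p: "prime p" and pn: "p = 2 * n + 1" and n: "odd n"
begin

text \<open>\<open>legendre n\<close> is odd under reflection, so replacing F by F - P does not
  change the sum, and F - P is divisible by p^2.\<close>

lemma poly_pmult_trunc_series_reflect:
  "poly_pmult p 2 (trunc_series p + pcompose (trunc_series p) [:1, -1:])"
proof -
  let ?R = "[:1, -1:] :: rat poly" and ?F = "trunc_series p" and ?P = "legendre n"
  have "pmult p 2 (coeff (?F - ?P) k)" for k
  proof (cases "k < p")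
    case True
    then show ?thesis
      using cbin_square_cong[OF p pn, of k] by (simp add: coeff_trunc_series coeff_legendre)
  next
    case False
    moreover from this have "n < k" using pn by simp
    ultimately show ?thesis by (simp add: coeff_trunc_series coeff_legendre lcoeff_eq_0 p)
  qed
  then have D: "poly_pmult p 2 (?F - ?P)" by (simp add: poly_pmult_def)
  have "?F + pcompose ?F ?R = (?F - ?P) + pcompose (?F - ?P) ?R"
    using legendre_reflect[of n] n by (simp add: pcompose_diff)
  then show ?thesis
    using poly_pmult_add[OF p D poly_pmult_pcompose[OF p D poly_pmult_reflect[OF p pn n]]]
    by (simp only:)
qed

lemma trunc_series_cong: "pmult p 3 (poly (trunc_series p) 2 + poly (trunc_series p) (-1))"
proof -
  let ?R = "[:1, -1:] :: rat poly" and ?F = "trunc_series p" and ?P = "legendre n"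
  define H where "H = ?F + pcompose ?F ?R"
  define c :: rat where "c = (of_nat (2 * n) + 1 / 2) ^ 2 * cbin (2 * n) ^ 2"
  define A where "A = legendre_moment n p"
  define W where "W = [:0, 1, -1:] * (?P * pderiv H - pderiv ?P * H)"
  \<comment> \<open>\<open>W\<close> with the main part of its derivative integrated away, so that
    the derivative of \<open>V\<close> is divisible by p^4.\<close>
  define V where "V = W + smult c (A + pcompose A ?R)"
  have H: "poly_pmult p 2 H" unfolding H_def by (rule poly_pmult_trunc_series_reflect)
  have c: "pmult p 2 c"
  proof -
    have "pmult p 2 (cbin (2 * n) ^ 2)"
      using cbin_square_cong[OF p pn, of "2 * n"] pn n by (auto simp: lcoeff_eq_0 elim: oddE)
    moreover have "of_nat (2 * n) + 1 / 2 = of_nat (4 * n + 1) * (1 / 2 :: rat)"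
      by (simp add: field_simps)
    then have "pmult p 0 (of_nat (2 * n) + 1 / 2)"
      using pmult_0_mult[OF p pmult_of_nat[OF p] pmult_half[OF p pn]] by (simp only:)
    ultimately show ?thesis
      unfolding c_def by (intro pmult_mult_left[OF p] pmult_0_power[OF p])
  qed
  have A': "pderiv A = ?P * monom 1 (2 * n)"
    unfolding A_def using pn by (simp add: pderiv_legendre_moment)
  have PR: "pcompose ?P ?R = - ?P" using legendre_reflect[of n] n by simp
  have AR': "pderiv (pcompose A ?R) = ?P * pcompose (monom 1 (2 * n)) ?R"
    by (simp add: pderiv_pcompose pderiv_pCons A' pcompose_mult PR)
  have "hypergeom_op (- 1 / 4) ?F = - monom c (2 * n)"
    using hypergeom_op_trunc_series[of "2 * n"] unfolding pn c_def by simp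
  then have LF: "hypergeom_op (- 1 / 4) ?F = - smult c (monom 1 (2 * n))"
    by (simp add: smult_monom)
  have LH: "hypergeom_op (- 1 / 4) H = - smult c (monom 1 (2 * n) + pcompose (monom 1 (2 * n)) ?R)"
    unfolding H_def hypergeom_op_add hypergeom_op_reflect LF
    by (simp add: pcompose_uminus pcompose_smult smult_add_right)
  \<comment> \<open>The gap between the two equations, (n + 1/2)^2 = p^2/4, contributes p^2 to the
    derivative of \<open>V\<close>, and \<open>H\<close> another p^2.\<close>
  have d: "of_nat (n * Suc n) - (- 1 / 4) = of_nat p ^ 2 * (1 / 2) ^ 2 * (1 :: rat)"
    unfolding pn by (simp add: power2_eq_square field_simps)
  have "pderiv W = - smult c (?P * monom 1 (2 * n) + ?P * pcompose (monom 1 (2 * n)) ?R)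
      + smult (of_nat p ^ 2 * (1 / 2) ^ 2) (?P * H)"
    unfolding W_def pderiv_wronskian[of ?P H "- 1 / 4" "of_nat (n * Suc n)"] LH hypergeom_op_legendre d
    by (simp add: algebra_simps)
  then have V': "pderiv V = smult (of_nat p ^ 2 * (1 / 2) ^ 2) (?P * H)"
    unfolding V_def pderiv_add pderiv_smult A' AR' by simp
  have "poly_pmult p (0 + 2) (?P * H)"
    by (rule poly_pmult_mult[OF p poly_pmult_legendre[OF p pn n] H])
  then have PH: "pmult p 2 (coeff (?P * H) k)" for k
    by (simp only: poly_pmult_def add_0)
  have V4: "pmult p 4 (coeff (pderiv V) k)" for k
    using pmult_mult[OF p pmult_mult_right[OF p pmult_p_power[OF p] pmult_0_power[OF p pmult_half[OF p pn]]] PH, of 2 2 k]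
    unfolding V' by simp
  have degF: "degree ?F \<le> 2 * n"
    by (rule degree_le) (simp add: coeff_trunc_series pn)
  then have degH: "degree H \<le> 2 * n"
    unfolding H_def by (intro degree_add_le) (simp_all add: degree_pcompose)
  \<comment> \<open>Dividing by the index costs a factor p only at index p itself: the next multiple
    2p lies beyond 3n + 1, which bounds the degree of \<open>V\<close>.\<close>
  have V3: "pmult p 3 (coeff V (Suc k))" for k
  proof (cases "p dvd Suc k")
    case False
    have "pmult p 4 (of_nat (Suc k) * coeff V (Suc k))" using V4[of k] by (simp only: coeff_pderiv)
    from pmult_cancel_nat[OF p this False] show ?thesis by (rule pmult_mono[OF p]) simp
  next
    case True
    show ?thesis
    proof (cases "Suc k = p")
      case True
      have "pmult p (Suc 3) (of_nat p * coeff V p)"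
        using V4[of k] unfolding coeff_pderiv True by simp
      then show ?thesis unfolding True by (rule pmult_p_cancel[OF p])
    next
      case False
      obtain t where t: "Suc k = p * t" using \<open>p dvd Suc k\<close> by blast
      with False have "t \<noteq> 0" "t \<noteq> 1" by (auto intro: gr0I)
      then have "2 * p \<le> Suc k" unfolding t by simp
      then have "degree (?P * H) < k"
        using degree_mult_le[of ?P H] degH pn by (simp add: degree_legendre)
      then have "of_nat (Suc k) * coeff V (Suc k) = 0"
        unfolding coeff_pderiv[symmetric] V' by (simp add: coeff_eq_0)
      then show ?thesis by (simp add: p del: of_nat_Suc)
    qed
  qed
  \<comment> \<open>The constant term cancels in V(-1) - V(0), so only the coefficients covered by
    \<open>V3\<close> enter.\<close>
  obtain v V1 where V1: "V = pCons v V1" by (cases V)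
  have m1: "pmult p 0 (- 1)" using pmult_minus[OF p pmult_1[OF p]] .
  have "poly_pmult p 3 V1" using V3 unfolding poly_pmult_def V1 by simp
  from pmult_minus[OF p pmult_poly[OF p this m1]]
  have "pmult p 3 (poly V (- 1) - poly V 0)" by (simp add: V1)
  moreover have "poly A 0 = 0"
    unfolding A_def poly_legendre_moment using prime_gt_0_nat[OF p]
    by (intro sum.neutral) simp
  then have "poly V 0 = c * poly A 1"
    by (simp add: V_def W_def poly_pcompose)
  moreover have "poly V (- 1) = poly W (- 1) + c * (poly A (-1) + poly A 2)"
    by (simp add: V_def poly_pcompose)
  ultimately have "pmult p 3 (poly W (- 1) + c * (poly A (-1) + poly A 2 - poly A 1))"
    by (simp add: algebra_simps)
  moreover have "pmult p (2 + 1) (c * (poly A (-1) + poly A 2 - poly A 1))"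
    unfolding A_def by (rule pmult_mult[OF p c legendre_moment_cong[OF p pn n]])
  ultimately have W: "pmult p 3 (poly W (- 1))"
    using pmult_diff[OF p] by fastforce
  \<comment> \<open>At -1 the factor x(1-x) is -2. P(-1) gives one p and the derivative of
    \<open>H\<close> gives p^2, so only P'(-1) H(-1) remains.\<close>
  have "pmult p (1 + 2) (poly ?P (-1) * poly (pderiv H) (-1))"
    by (intro pmult_mult[OF p] poly_legendre_minus1[OF p pn n] pmult_poly[OF p] poly_pmult_pderiv[OF p] H m1)
  then have "pmult p 3 (poly ?P (-1) * poly (pderiv H) (-1))" by (simp add: numeral_3_eq_3)
  then have "pmult p 3 (poly W (-1) * (1 / 2) + poly ?P (-1) * poly (pderiv H) (-1))"
    by (rule pmult_add[OF p pmult_mult_right[OF p W pmult_half[OF p pn]]])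
  moreover have "poly W (-1) * (1 / 2) + poly ?P (-1) * poly (pderiv H) (-1)
      = poly (pderiv ?P) (-1) * poly H (-1)"
    by (simp add: W_def field_simps)
  ultimately have "pmult p 3 (poly (pderiv ?P) (-1) * poly H (-1))" by (simp only:)
  then have "pmult p 3 (poly H (-1))"
    by (rule pmult_cancel_unit[OF p _ pmult_poly[OF p poly_pmult_pderiv[OF p poly_pmult_legendre[OF p pn n]] m1]
        poly_pderiv_legendre_minus1[OF p pn n]])
  then show ?thesis by (simp add: H_def poly_pcompose add.commute)
qed

end

theorem theorem1p1:
  fixes p :: nat
  assumes "prime p" and "p mod 4 = 3"
  shows "rat_cong_pow
           (\<Sum>k=0..p-1. of_nat ((2*k choose k)^2) / 8^k)
           (- (\<Sum>k=0..p-1. of_nat ((2*k choose k)^2) / (-16)^k))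
           p 3"
proof -
  define n where "n = p div 2"
  have pn: "p = 2 * n + 1" and n: "odd n" using assms(2) unfolding n_def by presburger+
  have I: "{0..p-1} = {..<p}" using pn by auto
  \<comment> \<open>As \<open>cbin k ^ 2\<close> carries 16^k in its denominator, the bases 8 and
    -16 correspond to the points 2 and -1.\<close>
  have "of_nat ((2*k choose k)^2) / 8 ^ k = cbin k ^ 2 * 2 ^ k" for k
  proof -
    have "(16 :: rat) ^ k = 8 ^ k * 2 ^ k" by (simp flip: power_mult_distrib)
    then show ?thesis unfolding cbin_square by simp
  qed
  then have 1: "(\<Sum>k=0..p-1. of_nat ((2*k choose k)^2) / 8^k) = poly (trunc_series p) 2"
    unfolding poly_trunc_series I by simp
  have "of_nat ((2*k choose k)^2) / (-16) ^ k = cbin k ^ 2 * (-1) ^ k" for k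
  proof -
    have "(- 16 :: rat) ^ k = 16 ^ k * (-1) ^ k" by (simp flip: power_mult_distrib)
    then show ?thesis unfolding cbin_square by (simp add: minus_one_power_iff)
  qed
  then have 2: "(\<Sum>k=0..p-1. of_nat ((2*k choose k)^2) / (-16)^k) = poly (trunc_series p) (-1)"
    unfolding poly_trunc_series I by simp
  show ?thesis
    using trunc_series_cong[OF assms(1) pn n]
    unfolding rat_cong_pow_def 1 2 pmult_def by simp
qed

end
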